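(* $\mathsf{TT}^1_2 <_{\mathrm{W}} \mathsf{V}_0 \equiv_{\mathrm{W}} \mathsf{V}_1 <_{\mathrm{W}} \mathsf{V}_2 \equiv_{\mathrm{W}} \mathsf{V}_3 \equiv_{\mathrm{W}} \mathsf{V}_4$.
   Context: A problem $\mathsf{P}$ is a partial multivalued function from $\omega^\omega$ to $\omega^\omega$; elements of its domain are its instances, and for each instance $x$ the set $\mathsf{P}(x)$ of its solutions is nonempty. All objects are coded as elements of $\omega^\omega$ via standard codings. $\mathsf{P} \leq_{\mathrm{W}} \mathsf{Q}$ means there are Turing functionals $\Phi,\Psi$ such that for every instance $x$ of $\mathsf{P}$, $\Phi(x)$ is an instance of $\mathsf{Q}$, and for every $\mathsf{Q}$-solution $y$ of $\Phi(x)$, $\Psi(x\oplus y)$ is a $\mathsf{P}$-solution of $x$; $\equiv_{\mathrm{W}}$ means reducibility in both directions, and $\mathsf{P}<_{\mathrm{W}}\mathsf{Q}$ means $\mathsf{P}\leq_{\mathrm{W}}\mathsf{Q}$ and $\mathsf{Q}\not\leq_{\mathrm{W}}\mathsf{P}$. $\preceq$ is the prefix order on $2^{<\omega}$; $S\cong 2^{<\omega}$ means $(S,\preceq)$ is order-isomorphic to $(2^{<\omega},\preceq)$; $H$ is monochromatic for $f$ if $f$ is constant on $H$. $\mathsf{TT}^1_2$ is the problem whose instances are all $f:2^{<\omega}\to 2$, with solutions all $H\cong 2^{<\omega}$ monochromatic for $f$. A set $D\subseteq 2^{<\omega}$ is dense above $\sigma$ if every $\rho\succeq\sigma$ has an extension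 $\tau\succeq\rho$ in $D$; dense means dense above the empty string. The problems $\mathsf{V}_0,\dots,\mathsf{V}_4$ all have as instances all $f:2^{<\omega}\to 2$, with solutions: $\mathsf{V}_0$: all pairs $\langle i,\sigma\rangle\in 2\times 2^{<\omega}$ with $\{\tau: f(\tau)=i\}$ dense above $\sigma$. $\mathsf{V}_1$: all $\langle i,\sigma\rangle$ such that either $\{\tau:f(\tau)=0\}$ and $\{\tau:f(\tau)=1\}$ are both dense, or $f(\tau)=i$ for all $\tau\succeq\sigma$. $\mathsf{V}_2$: all $\langle i,\sigma\rangle$ such that if $i=0$ then $\{\tau:f(\tau)=0\}$ is dense, and if $i=1$ then $\{\tau:f(\tau)=1\}$ is dense above $\sigma$. $\mathsf{V}_3$: all $\langle i,\sigma\rangle$ such that if $i=0$ then $\{\tau:f(\tau)=0\}$ is dense, and if $i=1$ then all $\tau\succeq\sigma$ with $f(\tau)=0$ are pairwise $\preceq$-comparable. $\mathsf{V}_4$: all $\langle i,\sigma\rangle$ such that if $i=0$ then $\{\tau:f(\tau)=0\}$ is dense, and if $i=1$ then $f(\tau)=1$ for all $\tau\succeq\sigma$. *)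

theory Defs
  imports Main "HOL-Library.Sublist" "HOL-Library.Nat_Bijection"
begin

section \<open>Turing functionals\<close>

type_synonym baire = "nat \<Rightarrow> nat"

text \<open>
  Partial recursive functions relative to a function in Baire space, in Kleene's style: the initial
  functions, queries to the given function, composition, primitive recursion on the first argument,
  and unbounded search.
\<close>

datatype recfn =
    Zero
  | Succ
  | Proj nat
  | Query
  | Comp recfn "recfn list"
  | PrimRec recfn recfn
  | Mu recfn

inductive rec_eval :: "baire \<Rightarrow> recfn \<Rightarrow> nat list \<Rightarrow> nat \<Rightarrow> bool" for x :: baire where
  rec_eval_Zero: "rec_eval x Zero ns 0"
| rec_eval_Succ: "rec_eval x Succ [n] (Suc n)"
| rec_eval_Proj: "i < length ns \<Longrightarrow> rec_eval x (Proj i) ns (ns ! i)"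
| rec_eval_Query: "rec_eval x Query [n] (x n)"
| rec_eval_Comp: "list_all2 (\<lambda>g v. rec_eval x g ns v) gs vs \<Longrightarrow> rec_eval x f vs r \<Longrightarrow> rec_eval x (Comp f gs) ns r"
| rec_eval_PrimRec_0: "rec_eval x g ns r \<Longrightarrow> rec_eval x (PrimRec g h) (0 # ns) r"
| rec_eval_PrimRec_Suc: "rec_eval x (PrimRec g h) (n # ns) q \<Longrightarrow> rec_eval x h (n # q # ns) r
    \<Longrightarrow> rec_eval x (PrimRec g h) (Suc n # ns) r"
| rec_eval_Mu: "rec_eval x f (n # ns) 0 \<Longrightarrow> \<forall>m<n. \<exists>v>0. rec_eval x f (m # ns) v \<Longrightarrow> rec_eval x (Mu f) ns n"

inductive_cases rec_eval_elims:
  "rec_eval x Zero ns r"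
  "rec_eval x Succ ns r"
  "rec_eval x (Proj i) ns r"
  "rec_eval x Query ns r"
  "rec_eval x (Comp f gs) ns r"
  "rec_eval x (PrimRec g h) (0 # ns) r"
  "rec_eval x (PrimRec g h) (Suc n # ns) r"
  "rec_eval x (Mu f) ns r"

lemma rec_eval_deterministic: "rec_eval x e ns r \<Longrightarrow> rec_eval x e ns r' \<Longrightarrow> r = r'"
proof (induction arbitrary: r' rule: rec_eval.induct)
  case (rec_eval_Zero ns)
  then show ?case by (rule rec_eval_elims) simp
next
  case (rec_eval_Succ n)
  then show ?case by (rule rec_eval_elims) simp
next
  case (rec_eval_Proj i ns)
  from rec_eval_Proj.prems show ?case by (rule rec_eval_elims) simp
next
  case (rec_eval_Query n)
  then show ?case by (rule rec_eval_elims) simp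
next
  case (rec_eval_Comp ns gs vs f r)
  from rec_eval_Comp.prems obtain ws
    where ws: "list_all2 (\<lambda>g v. rec_eval x g ns v) gs ws" "rec_eval x f ws r'"
    by (rule rec_eval_elims)
  have "vs = ws"
    using rec_eval_Comp.IH(1) ws(1) by (auto simp: list_all2_conv_all_nth intro!: nth_equalityI)
  with rec_eval_Comp.IH(2) ws(2) show ?case by simp
next
  case (rec_eval_PrimRec_0 g ns r h)
  from rec_eval_PrimRec_0.prems have "rec_eval x g ns r'" by (rule rec_eval_elims)
  with rec_eval_PrimRec_0.IH show ?case by simp
next
  case (rec_eval_PrimRec_Suc g h n ns q r)
  from rec_eval_PrimRec_Suc.prems obtain q'
    where "rec_eval x (PrimRec g h) (n # ns) q'" "rec_eval x h (n # q' # ns) r'"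
    by (rule rec_eval_elims)
  with rec_eval_PrimRec_Suc.IH show ?case by simp
next
  case (rec_eval_Mu f n ns)
  from rec_eval_Mu.prems have
    r': "rec_eval x f (r' # ns) 0" "\<forall>m<r'. \<exists>v>0. rec_eval x f (m # ns) v"
    by (auto elim: rec_eval_elims(8))
  show ?case
  proof (rule linorder_cases[of n r'])
    assume "n < r'"
    with r'(2) obtain v where "v > 0" "rec_eval x f (n # ns) v" by blast
    with rec_eval_Mu.IH(1) show ?thesis by (metis less_irrefl)
  next
    assume "r' < n"
    with rec_eval_Mu.IH(2) obtain v where "v > 0" "\<And>w. rec_eval x f (r' # ns) w \<Longrightarrow> v = w" by blast
    with r'(1) show ?thesis by (metis less_irrefl)
  qed
qed

text \<open>
  The program \<open>e\<close> denotes the partial Turing functional sending \<open>x\<close> to the unique \<open>y\<close> with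
  \<open>turing_functional e x y\<close>; it is undefined at \<open>x\<close> if the unary function computed from \<open>x\<close>
  is not total.
\<close>

definition turing_functional :: "recfn \<Rightarrow> baire \<Rightarrow> baire \<Rightarrow> bool" where
  "turing_functional e x y \<longleftrightarrow> (\<forall>n. rec_eval x e [n] (y n))"

lemma turing_functional_unique:
  "turing_functional e x y \<Longrightarrow> turing_functional e x y' \<Longrightarrow> y = y'"
  unfolding turing_functional_def by (rule ext) (blast intro: rec_eval_deterministic)

definition join :: "baire \<Rightarrow> baire \<Rightarrow> baire" (infixl "\<oplus>" 65) where
  "(x \<oplus> y) n = (if even n then x (n div 2) else y (n div 2))"


section \<open>Problems and Weihrauch reducibility\<close>

text \<open>A problem is given by its domain and the set of solutions of each of its instances.\<close>

record problem =
  inst :: "baire set"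
  sol :: "baire \<Rightarrow> baire set"

definition is_problem :: "problem \<Rightarrow> bool" where
  "is_problem P \<longleftrightarrow> (\<forall>x\<in>inst P. sol P x \<noteq> {})"

definition weihrauch_le :: "problem \<Rightarrow> problem \<Rightarrow> bool" (infix "\<le>\<^sub>W" 50) where
  "P \<le>\<^sub>W Q \<longleftrightarrow> (\<exists>\<Phi> \<Psi>. \<forall>x\<in>inst P. \<exists>z. turing_functional \<Phi> x z \<and> z \<in> inst Q \<and>
     (\<forall>y\<in>sol Q z. \<exists>w. turing_functional \<Psi> (x \<oplus> y) w \<and> w \<in> sol P x))"

definition weihrauch_equiv :: "problem \<Rightarrow> problem \<Rightarrow> bool" (infix "\<equiv>\<^sub>W" 50) where
  "P \<equiv>\<^sub>W Q \<longleftrightarrow> P \<le>\<^sub>W Q \<and> Q \<le>\<^sub>W P"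

definition weihrauch_less :: "problem \<Rightarrow> problem \<Rightarrow> bool" (infix "<\<^sub>W" 50) where
  "P <\<^sub>W Q \<longleftrightarrow> P \<le>\<^sub>W Q \<and> \<not> Q \<le>\<^sub>W P"


section \<open>Codings\<close>

text \<open>
  Binary strings are of type \<open>bool list\<close> and colours of type \<open>bool\<close>, with \<open>False\<close> for 0 and \<open>True\<close>
  for 1. A string is coded by its position in the length-lexicographic order.
\<close>

definition str_code :: "bool list \<Rightarrow> nat" where
  "str_code \<sigma> = foldl (\<lambda>n b. 2 * n + 1 + of_bool b) 0 \<sigma>"

lemma str_code_Nil [simp]: "str_code [] = 0"
  and str_code_snoc [simp]: "str_code (\<sigma> @ [b]) = 2 * str_code \<sigma> + 1 + of_bool b"
  by (simp_all add: str_code_def)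

lemma bij_str_code: "bij str_code"
proof (rule bijI)
  have "str_code \<sigma> = str_code \<tau> \<Longrightarrow> \<sigma> = \<tau>" for \<sigma> \<tau>
  proof (induction \<sigma> arbitrary: \<tau> rule: rev_induct)
    case Nil
    then show ?case by (cases \<tau> rule: rev_cases) auto
  next
    case (snoc b \<sigma>)
    then show ?case
    proof (cases \<tau> rule: rev_cases)
      case (snoc \<rho> c)
      with snoc.prems have "2 * str_code \<sigma> + of_bool b = 2 * str_code \<rho> + of_bool c" by simp
      then have "b = c \<and> str_code \<sigma> = str_code \<rho>" by (cases b; cases c; simp; presburger?)
      with snoc snoc.IH show ?thesis by simp
    qed auto
  qed
  then show "inj str_code" by (rule injI)
  have "\<exists>\<sigma>. str_code \<sigma> = n" for n
  proof (induction n rule: less_induct)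
    case (less n)
    show ?case
    proof (cases "n = 0")
      case True
      then show ?thesis by (intro exI[of _ "[]"]) simp
    next
      case False
      then have "(n - 1) div 2 < n" by linarith
      with less obtain \<sigma> where "str_code \<sigma> = (n - 1) div 2" by blast
      with False have "str_code (\<sigma> @ [even n]) = n" by (auto elim!: evenE oddE)
      then show ?thesis ..
    qed
  qed
  then show "surj str_code" by (metis surjI)
qed

definition coloring_code :: "(bool list \<Rightarrow> bool) \<Rightarrow> baire" where
  "coloring_code f n = of_bool (f (inv str_code n))"

definition set_code :: "bool list set \<Rightarrow> baire" where
  "set_code H n = of_bool (inv str_code n \<in> H)"

definition pair_code :: "bool \<times> bool list \<Rightarrow> baire" where
  "pair_code p n = prod_encode (of_bool (fst p), str_code (snd p))"

lemma inj_coloring_code: "inj coloring_code"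
proof (rule injI, rule ext)
  fix f g \<tau>
  assume "coloring_code f = coloring_code g"
  then have "coloring_code f (str_code \<tau>) = coloring_code g (str_code \<tau>)" by simp
  then show "f \<tau> = g \<tau>"
    using bij_str_code by (cases "f \<tau>"; cases "g \<tau>") (simp_all add: coloring_code_def bij_is_inj)
qed

text \<open>
  The problem with instances all 2-colourings \<open>f\<close> of the binary strings and solutions \<open>S f\<close>, where \<open>c\<close> codes the solutions.
\<close>

definition coloring_problem :: "('b \<Rightarrow> baire) \<Rightarrow> ((bool list \<Rightarrow> bool) \<Rightarrow> 'b set) \<Rightarrow> problem" where
  "coloring_problem c S =
     \<lparr>inst = range coloring_code, sol = (\<lambda>x. {c s | f s. x = coloring_code f \<and> s \<in> S f})\<rparr>"

lemma sol_coloring_problem: "sol (coloring_problem c S) (coloring_code f) = c ` S f"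
  using inj_coloring_code by (auto simp: coloring_problem_def inj_eq)

lemma is_problem_coloring_problem: "is_problem (coloring_problem c S) \<longleftrightarrow> (\<forall>f. S f \<noteq> {})"
proof -
  have "inst (coloring_problem c S) = range coloring_code" by (simp add: coloring_problem_def)
  then show ?thesis by (simp add: is_problem_def sol_coloring_problem)
qed


section \<open>The tree theorem and its variants\<close>

definition iso_full_tree :: "bool list set \<Rightarrow> bool" where
  "iso_full_tree S \<longleftrightarrow>
     (\<exists>h :: bool list \<Rightarrow> bool list. bij_betw h UNIV S \<and> (\<forall>\<sigma> \<tau>. prefix (h \<sigma>) (h \<tau>) \<longleftrightarrow> prefix \<sigma> \<tau>))"

definition monochromatic :: "(bool list \<Rightarrow> bool) \<Rightarrow> bool list set \<Rightarrow> bool" where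
  "monochromatic f H \<longleftrightarrow> (\<exists>i. \<forall>\<tau>\<in>H. f \<tau> = i)"

definition dense_above :: "bool list set \<Rightarrow> bool list \<Rightarrow> bool" where
  "dense_above D \<sigma> \<longleftrightarrow> (\<forall>\<rho>. prefix \<sigma> \<rho> \<longrightarrow> (\<exists>\<tau>\<in>D. prefix \<rho> \<tau>))"

abbreviation dense_str :: "bool list set \<Rightarrow> bool" where
  "dense_str D \<equiv> dense_above D []"

definition TT12 :: problem where
  "TT12 = coloring_problem set_code (\<lambda>f. {H. iso_full_tree H \<and> monochromatic f H})"

definition V0 :: problem where
  "V0 = coloring_problem pair_code (\<lambda>f. {(i, \<sigma>). dense_above {\<tau>. f \<tau> = i} \<sigma>})"

definition V1 :: problem where
  "V1 = coloring_problem pair_code (\<lambda>f. {(i, \<sigma>).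
     dense_str {\<tau>. f \<tau> = False} \<and> dense_str {\<tau>. f \<tau> = True} \<or>
     (\<forall>\<tau>. prefix \<sigma> \<tau> \<longrightarrow> f \<tau> = i)})"

definition V2 :: problem where
  "V2 = coloring_problem pair_code (\<lambda>f. {(i, \<sigma>).
     (i = False \<longrightarrow> dense_str {\<tau>. f \<tau> = False}) \<and>
     (i = True \<longrightarrow> dense_above {\<tau>. f \<tau> = True} \<sigma>)})"

definition V3 :: problem where
  "V3 = coloring_problem pair_code (\<lambda>f. {(i, \<sigma>).
     (i = False \<longrightarrow> dense_str {\<tau>. f \<tau> = False}) \<and>
     (i = True \<longrightarrow> (\<forall>\<tau> \<tau>'. prefix \<sigma> \<tau> \<and> prefix \<sigma> \<tau>' \<and> f \<tau> = False \<and> f \<tau>' = False \<longrightarrow>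
        prefix \<tau> \<tau>' \<or> prefix \<tau>' \<tau>))})"

definition V4 :: problem where
  "V4 = coloring_problem pair_code (\<lambda>f. {(i, \<sigma>).
     (i = False \<longrightarrow> dense_str {\<tau>. f \<tau> = False}) \<and>
     (i = True \<longrightarrow> (\<forall>\<tau>. prefix \<sigma> \<tau> \<longrightarrow> f \<tau> = True))})"

text \<open>Every instance of each of these problems has a solution.\<close>

lemma not_dense_cone:
  assumes "\<not> dense_str {\<tau>. f \<tau> = i}"
  shows "\<exists>\<sigma>. \<forall>\<tau>. prefix \<sigma> \<tau> \<longrightarrow> f \<tau> = (\<not> i)"
  using assms unfolding dense_above_def by auto

lemma cone_dense_above:
  assumes "\<forall>\<tau>. prefix \<sigma> \<tau> \<longrightarrow> f \<tau> = i"
  shows "dense_above {\<tau>. f \<tau> = i} \<sigma>"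
  using assms unfolding dense_above_def by blast

lemma ex_dense_above: "\<exists>(i::bool) \<sigma>. dense_above {\<tau>. f \<tau> = i} \<sigma>"
proof (cases "dense_str {\<tau>. f \<tau> = True}")
  case True
  then show ?thesis by blast
next
  case False
  from not_dense_cone[OF this] obtain \<sigma> where "\<forall>\<tau>. prefix \<sigma> \<tau> \<longrightarrow> f \<tau> = (\<not> True)" ..
  from cone_dense_above[OF this] show ?thesis by blast
qed

lemma ex_monochromatic_tree:
  fixes f :: "bool list \<Rightarrow> bool"
  shows "\<exists>H. iso_full_tree H \<and> monochromatic f H"
proof -
  from ex_dense_above[of f] obtain i \<sigma> where "dense_above {\<tau>. f \<tau> = i} \<sigma>" by (elim exE)
  then have "\<forall>\<rho>. \<exists>\<tau>. prefix \<sigma> \<rho> \<longrightarrow> f \<tau> = i \<and> prefix \<rho> \<tau>"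
    unfolding dense_above_def by auto
  from choice[OF this] obtain e where
    e: "\<And>\<rho>. prefix \<sigma> \<rho> \<Longrightarrow> f (e \<rho>) = i \<and> prefix \<rho> (e \<rho>)" by auto
  define h where "h = foldl (\<lambda>\<rho> b. e (\<rho> @ [b])) (e \<sigma>)"
  have h_Nil: "h [] = e \<sigma>" and h_snoc: "h (\<rho> @ [b]) = e (h \<rho> @ [b])" for \<rho> b
    by (simp_all add: h_def)
  have h_col: "prefix \<sigma> (h \<rho>) \<and> f (h \<rho>) = i" for \<rho>
  proof (induction \<rho> rule: rev_induct)
    case Nil
    show ?case using e[of \<sigma>] by (simp add: h_Nil)
  next
    case (snoc b \<rho>)
    then have "prefix \<sigma> (h \<rho> @ [b])" by (simp add: prefix_prefix)
    with e[OF this] show ?case by (metis h_snoc prefix_order.order_trans)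
  qed
  have step: "prefix (h \<rho> @ [b]) (h (\<rho> @ [b]))" for \<rho> b
    using e[of "h \<rho> @ [b]"] h_col[of \<rho>] by (simp add: h_snoc prefix_prefix)
  have mono: "prefix (h \<rho>) (h (\<rho> @ \<tau>))" for \<rho> \<tau>
  proof (induction \<tau> rule: rev_induct)
    case (snoc b \<tau>)
    then show ?case
      using step[of "\<rho> @ \<tau>" b] by (metis append_assoc append_prefixD prefix_order.order_trans)
  qed simp
  have next_mono: "prefix (h \<rho> @ [b]) (h (\<rho> @ b # \<tau>))" for \<rho> b \<tau>
    using step[of \<rho> b] mono[of "\<rho> @ [b]" \<tau>] by (auto intro: prefix_order.order_trans)
  have iff: "prefix (h \<rho>) (h \<tau>) \<longleftrightarrow> prefix \<rho> \<tau>" for \<rho> \<tau>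
  proof
    assume "prefix \<rho> \<tau>"
    then show "prefix (h \<rho>) (h \<tau>)" using mono by (auto simp: prefix_def)
  next
    assume le: "prefix (h \<rho>) (h \<tau>)"
    show "prefix \<rho> \<tau>"
    proof (cases rule: prefix_cases[of \<rho> \<tau>])
      case 2
      then obtain b \<upsilon> where "\<rho> = \<tau> @ b # \<upsilon>" by (auto elim: strict_prefixE')
      with next_mono[of \<tau> b \<upsilon>] have "length (h \<tau>) < length (h \<rho>)"
        by (metis Suc_le_eq length_append_singleton prefix_length_le)
      with prefix_length_le[OF le] show ?thesis by simp
    next
      case 3
      from parallel_decomp[OF this] obtain \<upsilon> b \<mu> c \<nu> where *: "b \<noteq> c" "\<rho> = \<upsilon> @ b # \<mu>" "\<tau> = \<upsilon> @ c # \<nu>"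
        by (elim exE conjE)
      have "prefix (h \<upsilon> @ [b]) (h \<tau>)"
        using next_mono[of \<upsilon> b \<mu>] le *(2) prefix_order.order_trans by metis
      moreover have "prefix (h \<upsilon> @ [c]) (h \<tau>)"
        using next_mono[of \<upsilon> c \<nu>] *(3) by simp
      ultimately have "[b] = [c]" by (auto simp: prefix_def)
      with * show ?thesis by simp
    qed
  qed
  have "inj h" by (rule injI) (metis iff prefix_order.eq_iff)
  then have "iso_full_tree (range h)"
    unfolding iso_full_tree_def using iff by (auto simp: bij_betw_def)
  moreover have "monochromatic f (range h)" using h_col by (auto simp: monochromatic_def)
  ultimately show ?thesis by blast
qed

lemma is_problem_TT12: "is_problem TT12"
  using ex_monochromatic_tree by (simp add: TT12_def is_problem_coloring_problem)

lemma is_problem_V0: "is_problem V0"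
  using ex_dense_above by (simp add: V0_def is_problem_coloring_problem)

lemma ex_dense_or_cone:
  obtains "dense_str {\<tau>. f \<tau> = False}" | \<sigma> where "\<forall>\<tau>. prefix \<sigma> \<tau> \<longrightarrow> f \<tau> = True"
  using not_dense_cone[of f False] by auto

lemma is_problem_V1: "is_problem V1"
  unfolding V1_def is_problem_coloring_problem
proof (intro allI)
  fix f
  consider "dense_str {\<tau>. f \<tau> = False} \<and> dense_str {\<tau>. f \<tau> = True}"
    | i \<sigma> where "\<forall>\<tau>. prefix \<sigma> \<tau> \<longrightarrow> f \<tau> = i"
    using not_dense_cone[of f True] not_dense_cone[of f False] by blast
  then show "{(i, \<sigma>). dense_str {\<tau>. f \<tau> = False} \<and> dense_str {\<tau>. f \<tau> = True} \<or>
      (\<forall>\<tau>. prefix \<sigma> \<tau> \<longrightarrow> f \<tau> = i)} \<noteq> {}"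
    by cases auto
qed

lemma is_problem_V2: "is_problem V2"
  unfolding V2_def is_problem_coloring_problem
proof (intro allI)
  fix f
  show "{(i, \<sigma>). (i = False \<longrightarrow> dense_str {\<tau>. f \<tau> = False}) \<and> (i = True \<longrightarrow> dense_above {\<tau>. f \<tau> = True} \<sigma>)} \<noteq> {}"
    (is "?S \<noteq> {}")
  proof (cases rule: ex_dense_or_cone[of f])
    case 1
    then have "(False, []) \<in> ?S" by simp
    then show ?thesis by blast
  next
    case (2 \<sigma>)
    from cone_dense_above[OF this] have "(True, \<sigma>) \<in> ?S" by simp
    then show ?thesis by blast
  qed
qed

lemma is_problem_V3: "is_problem V3"
  unfolding V3_def is_problem_coloring_problem
proof (intro allI)
  fix f
  show "{(i, \<sigma>). (i = False \<longrightarrow> dense_str {\<tau>. f \<tau> = False}) \<and> (i = True \<longrightarrow> 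
      (\<forall>\<tau> \<tau>'. prefix \<sigma> \<tau> \<and> prefix \<sigma> \<tau>' \<and> f \<tau> = False \<and> f \<tau>' = False \<longrightarrow>
        prefix \<tau> \<tau>' \<or> prefix \<tau>' \<tau>))} \<noteq> {}"
    (is "?S \<noteq> {}")
  proof (cases rule: ex_dense_or_cone[of f])
    case 1
    then have "(False, []) \<in> ?S" by simp
    then show ?thesis by blast
  next
    case (2 \<sigma>)
    then have "(True, \<sigma>) \<in> ?S" by blast
    then show ?thesis by blast
  qed
qed

lemma is_problem_V4: "is_problem V4"
  unfolding V4_def is_problem_coloring_problem
proof (intro allI)
  fix f
  show "{(i, \<sigma>). (i = False \<longrightarrow> dense_str {\<tau>. f \<tau> = False}) \<and> (i = True \<longrightarrow> (\<forall>\<tau>. prefix \<sigma> \<tau> \<longrightarrow> f \<tau> = True))} \<noteq> {}"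
    (is "?S \<noteq> {}")
  proof (cases rule: ex_dense_or_cone[of f])
    case 1
    then have "(False, []) \<in> ?S" by simp
    then show ?thesis by blast
  next
    case (2 \<sigma>)
    then have "(True, \<sigma>) \<in> ?S" by simp
    then show ?thesis by blast
  qed
qed

end

theory Submission
  imports Defs
begin

text \<open>
  A search over all pairs of a colour and a string for a cone of constant colour revises its guess
  at stages \<open>S\<close>; if \<open>S\<close> is finite the last guess is right, otherwise both colours are dense. A
  colouring computed from \<open>S\<close> has only solutions that are longer than the last stage of \<open>S\<close>, so
  reading the guess at the length of the solution gives V1 from V0, and similarly V4 from V2. A
  monochromatic tree is found greedily in a colour that is dense above a given string.

  To refute a reduction of V2 to V1, add stages to \<open>S\<close> one by one, so that \<open>S\<close> becomes infinite and
  only colour 0 is correct. Before each new stage \<open>S\<close> is finite and only colour 1 is correct. Hence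
  each pair either stops being a constant cone of the V1-instance, or makes the reduction output
  colour 1 for good. One pair of the second kind exists at the beginning, so in the end the
  V1-instance can neither have a constant cone nor have both colours dense.

  To refute a reduction of V0 to TT, take a finite tree of colour \<open>j\<close> on which the reduction outputs a
  solution, and add a stage that makes this output wrong. If \<open>j\<close> is now nowhere dense above some
  tip of the tree, then there is a finite tree of the other colour above this tip on which the
  reduction is again committed; one more stage makes that wrong too, and \<open>j\<close> is again somewhere
  dense above the tip, however the set of stages grows afterwards. After treating all tips the
  first tree extends to a monochromatic one although its output is wrong.
\<close>

section \<open>Total computable functionals\<close>

text \<open>The oracle is an argument of \<open>F\<close>, so one program serves all oracles;
  nothing is required on argument lists of other lengths.\<close>

definition computable :: "nat \<Rightarrow> (baire \<Rightarrow> nat list \<Rightarrow> nat) \<Rightarrow> bool" where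
  "computable k F \<longleftrightarrow> (\<exists>e. \<forall>x ns. length ns = k \<longrightarrow> rec_eval x e ns (F x ns))"

definition decidable :: "nat \<Rightarrow> (baire \<Rightarrow> nat list \<Rightarrow> bool) \<Rightarrow> bool" where
  "decidable k P \<longleftrightarrow> computable k (\<lambda>x ns. of_bool (P x ns))"

lemma computable_cong:
  assumes "computable k F" "\<And>x ns. length ns = k \<Longrightarrow> F x ns = G x ns"
  shows "computable k G"
  using assms unfolding computable_def by metis

lemma computable_compose_list:
  assumes F: "computable (length Gs) F" and Gs: "\<And>G. G \<in> set Gs \<Longrightarrow> computable k G"
  shows "computable k (\<lambda>x ns. F x (map (\<lambda>G. G x ns) Gs))"
proof -
  obtain e where e: "\<And>x ns. length ns = length Gs \<Longrightarrow> rec_eval x e ns (F x ns)"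
    using F unfolding computable_def by blast
  have "\<forall>G\<in>set Gs. \<exists>e. \<forall>x ns. length ns = k \<longrightarrow> rec_eval x e ns (G x ns)"
    using Gs unfolding computable_def by blast
  then obtain p where p: "\<And>G x ns. G \<in> set Gs \<Longrightarrow> length ns = k \<Longrightarrow> rec_eval x (p G) ns (G x ns)"
    by metis
  have "rec_eval x (Comp e (map p Gs)) ns (F x (map (\<lambda>G. G x ns) Gs))" if "length ns = k" for x ns
    by (rule rec_eval_Comp[where vs = "map (\<lambda>G. G x ns) Gs"])
      (use that in \<open>auto simp: list_all2_conv_all_nth intro!: p e\<close>)
  then show ?thesis unfolding computable_def by blast
qed

lemma computable_nth: "i < k \<Longrightarrow> computable k (\<lambda>x ns. ns ! i)"
  unfolding computable_def by (metis rec_eval_Proj)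

lemma computable_compose1:
  assumes "computable 1 (\<lambda>x ns. f x (hd ns))" "computable k A"
  shows "computable k (\<lambda>x ns. f x (A x ns))"
  using computable_compose_list[of "[A]" "\<lambda>x ns. f x (hd ns)" k] assms by simp

lemma computable_compose2:
  assumes "computable 2 (\<lambda>x ns. f x (hd ns) (hd (tl ns)))" "computable k A" "computable k B"
  shows "computable k (\<lambda>x ns. f x (A x ns) (B x ns))"
  using computable_compose_list[of "[A, B]" "\<lambda>x ns. f x (hd ns) (hd (tl ns))" k] assms
  by (fastforce simp: numeral_2_eq_2)

named_theorems comp_intros

text \<open>Arguments are addressed by iterated \<open>tl\<close>: the rules for recursion and
  bounded quantifiers prepend their variables, and the shifted arguments again match these
  patterns.\<close>

lemma computable_hd [comp_intros]:
  "0 < k \<Longrightarrow> computable k (\<lambda>x ns. hd ns)"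
  "1 < k \<Longrightarrow> computable k (\<lambda>x ns. hd (tl ns))"
  "2 < k \<Longrightarrow> computable k (\<lambda>x ns. hd (tl (tl ns)))"
  "3 < k \<Longrightarrow> computable k (\<lambda>x ns. hd (tl (tl (tl ns))))"
  "4 < k \<Longrightarrow> computable k (\<lambda>x ns. hd (tl (tl (tl (tl ns)))))"
  by (rule computable_cong[OF computable_nth],
      auto simp: hd_conv_nth nth_tl numeral_eq_Suc length_0_conv[symmetric] simp del: length_0_conv)+

lemma computable_Query [comp_intros]: "computable k A \<Longrightarrow> computable k (\<lambda>x ns. x (A x ns))"
proof (rule computable_compose1[where f = "\<lambda>x. x"])
  have "rec_eval x Query ns (x (hd ns))" if "length ns = 1" for x ns
    using that rec_eval_Query by (auto simp: length_Suc_conv)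
  then show "computable 1 (\<lambda>x ns. x (hd ns))" unfolding computable_def by blast
qed

lemma computable_Suc [comp_intros]: "computable k A \<Longrightarrow> computable k (\<lambda>x ns. Suc (A x ns))"
proof (rule computable_compose1[where f = "\<lambda>x. Suc"])
  have "rec_eval x Succ ns (Suc (hd ns))" if "length ns = 1" for x ns
    using that rec_eval_Succ by (auto simp: length_Suc_conv)
  then show "computable 1 (\<lambda>x ns. Suc (hd ns))" unfolding computable_def by blast
qed

lemma computable_const [comp_intros]: "computable k (\<lambda>x ns. c)"
proof (induction c)
  case 0
  show ?case unfolding computable_def by (blast intro: rec_eval_Zero)
next
  case (Suc c)
  then show ?case by (rule computable_Suc)
qed

lemma computable_rec_nat [comp_intros]:
  assumes G: "computable k G"
    and H: "computable (Suc (Suc k)) (\<lambda>x ns. H x (hd ns) (hd (tl ns)) (tl (tl ns)))"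
    and N: "computable k N"
  shows "computable k (\<lambda>x ns. rec_nat (G x ns) (\<lambda>n q. H x n q ns) (N x ns))"
proof -
  obtain g where g: "\<And>x ns. length ns = k \<Longrightarrow> rec_eval x g ns (G x ns)"
    using G unfolding computable_def by blast
  obtain h where h: "\<And>x ns. length ns = Suc (Suc k) \<Longrightarrow>
      rec_eval x h ns (H x (hd ns) (hd (tl ns)) (tl (tl ns)))"
    using H unfolding computable_def by blast
  have "rec_eval x (PrimRec g h) (n # ns) (rec_nat (G x ns) (\<lambda>n q. H x n q ns) n)"
    if "length ns = k" for x n ns
  proof (induction n)
    case 0
    show ?case using g[OF that] by (simp add: rec_eval_PrimRec_0)
  next
    case (Suc n)
    then show ?case using h[of "n # _ # ns"] that by (auto intro!: rec_eval_PrimRec_Suc)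
  qed
  then have "rec_eval x (PrimRec g h) ns (rec_nat (G x (tl ns)) (\<lambda>n q. H x n q (tl ns)) (hd ns))"
    if "length ns = Suc k" for x ns
    using that by (cases ns) auto
  then have "computable (Suc k) (\<lambda>x ns. rec_nat (G x (tl ns)) (\<lambda>n q. H x n q (tl ns)) (hd ns))"
    unfolding computable_def by blast
  then have "computable k (\<lambda>x ns. (\<lambda>x ns. rec_nat (G x (tl ns)) (\<lambda>n q. H x n q (tl ns)) (hd ns)) x
      (map (\<lambda>G. G x ns) (N # map (\<lambda>i x ns. ns ! i) [0..<k])))"
    by (intro computable_compose_list) (auto intro: N computable_nth)
  then show ?thesis
    by (rule computable_cong) (auto simp: comp_def map_nth)
qed

lemma computable_add [comp_intros]:
  assumes "computable k A" "computable k B"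
  shows "computable k (\<lambda>x ns. A x ns + B x ns)"
proof -
  have "rec_nat a (\<lambda>n q. Suc q) b = a + b" for a b by (induction b) auto
  moreover have "computable k (\<lambda>x ns. rec_nat (A x ns) (\<lambda>n q. Suc q) (B x ns))"
    by (intro comp_intros assms) simp
  ultimately show ?thesis by simp
qed

lemma computable_mult [comp_intros]:
  assumes "computable k A" "computable k B"
  shows "computable k (\<lambda>x ns. A x ns * B x ns)"
proof (rule computable_compose2[OF _ assms])
  have "rec_nat 0 (\<lambda>n q. q + a) b = a * b" for a b :: nat by (induction b) auto
  moreover have "computable 2 (\<lambda>x ns. rec_nat 0 (\<lambda>n q. q + hd ns) (hd (tl ns)))"
    by (intro comp_intros) simp_all
  ultimately show "computable 2 (\<lambda>x ns. hd ns * hd (tl ns))" by simp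
qed

lemma computable_power [comp_intros]:
  assumes "computable k A" "computable k B"
  shows "computable k (\<lambda>x ns. A x ns ^ B x ns)"
proof (rule computable_compose2[OF _ assms])
  have "rec_nat 1 (\<lambda>n q. q * a) b = a ^ b" for a b :: nat by (induction b) auto
  moreover have "computable 2 (\<lambda>x ns. rec_nat 1 (\<lambda>n q. q * hd ns) (hd (tl ns)))"
    by (intro comp_intros) simp_all
  ultimately show "computable 2 (\<lambda>x ns. hd ns ^ hd (tl ns))" by simp
qed

lemma computable_diff [comp_intros]:
  assumes "computable k A" "computable k B"
  shows "computable k (\<lambda>x ns. A x ns - B x ns)"
proof (rule computable_compose2[OF _ assms])
  have pred: "rec_nat 0 (\<lambda>n q. n) b = b - 1" for b :: nat by (cases b) auto
  have "computable 1 (\<lambda>x ns. rec_nat 0 (\<lambda>n q. n) (hd ns))"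
    by (intro comp_intros) simp_all
  then have pred': "computable k (\<lambda>x ns. A x ns - 1)" if "computable k A" for k A
    unfolding pred using that by (rule computable_compose1)
  have "rec_nat a (\<lambda>n q. q - 1) b = a - b" for a b :: nat by (induction b) auto
  moreover have "computable 2 (\<lambda>x ns. rec_nat (hd ns) (\<lambda>n q. q - 1) (hd (tl ns)))"
    by (intro comp_intros pred') simp_all
  ultimately show "computable 2 (\<lambda>x ns. hd ns - hd (tl ns))" by simp
qed

section \<open>Decidable relations, bounded quantifiers and unbounded search\<close>

lemma decidable_less [comp_intros]:
  assumes "computable k A" "computable k B"
  shows "decidable k (\<lambda>x ns. A x ns < B x ns)"
proof -
  have "computable k (\<lambda>x ns. 1 - (1 - (B x ns - A x ns)))"
    by (intro comp_intros assms)
  then show ?thesis unfolding decidable_def by (rule computable_cong) auto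
qed

lemma decidable_not [comp_intros]:
  assumes "decidable k P"
  shows "decidable k (\<lambda>x ns. \<not> P x ns)"
proof -
  have "computable k (\<lambda>x ns. 1 - of_bool (P x ns))"
    using assms unfolding decidable_def by (intro comp_intros)
  then show ?thesis unfolding decidable_def by (rule computable_cong) auto
qed

lemma decidable_conj [comp_intros]:
  assumes "decidable k P" "decidable k Q"
  shows "decidable k (\<lambda>x ns. P x ns \<and> Q x ns)"
proof -
  have "computable k (\<lambda>x ns. of_bool (P x ns) * of_bool (Q x ns))"
    using assms unfolding decidable_def by (intro comp_intros)
  then show ?thesis unfolding decidable_def by (rule computable_cong) auto
qed

lemma decidable_disj [comp_intros]:
  assumes "decidable k P" "decidable k Q"
  shows "decidable k (\<lambda>x ns. P x ns \<or> Q x ns)"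
proof -
  have "decidable k (\<lambda>x ns. \<not> (\<not> P x ns \<and> \<not> Q x ns))"
    by (intro comp_intros assms)
  then show ?thesis by simp
qed

lemma decidable_imp [comp_intros]:
  assumes "decidable k P" "decidable k Q"
  shows "decidable k (\<lambda>x ns. P x ns \<longrightarrow> Q x ns)"
  using decidable_disj[OF decidable_not[OF assms(1)] assms(2)] by simp

lemma decidable_le [comp_intros]:
  assumes "computable k A" "computable k B"
  shows "decidable k (\<lambda>x ns. A x ns \<le> B x ns)"
  using decidable_not[OF decidable_less[OF assms(2,1)]] by (simp add: not_less)

lemma decidable_eq [comp_intros]:
  assumes "computable k A" "computable k B"
  shows "decidable k (\<lambda>x ns. A x ns = B x ns)"
proof -
  have "decidable k (\<lambda>x ns. A x ns \<le> B x ns \<and> B x ns \<le> A x ns)"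
    by (intro comp_intros assms)
  then show ?thesis unfolding decidable_def by (rule computable_cong) auto
qed

lemma decidable_bex [comp_intros]:
  assumes P: "decidable (Suc k) (\<lambda>x ns. P x (hd ns) (tl ns))" and N: "computable k N"
  shows "decidable k (\<lambda>x ns. \<exists>m<N x ns. P x m ns)"
proof -
  have rec: "rec_nat (0::nat) (\<lambda>n q. q + of_bool (P x n ns)) b > 0 \<longleftrightarrow> (\<exists>m<b. P x m ns)" for x ns b
    by (induction b) (auto simp: less_Suc_eq)
  \<comment> \<open>Witnesses are counted by recursion. The step function receives the accumulator
    as second argument; the projections from index 2 on skip it.\<close>
  have "computable (Suc (Suc k)) (\<lambda>x ns. (\<lambda>x ns. of_bool (P x (hd ns) (tl ns))) x
      (map (\<lambda>G. G x ns) ((\<lambda>x ns. hd ns) # map (\<lambda>i x ns. ns ! (i + 2)) [0..<k])))"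
    by (rule computable_compose_list)
      (use P in \<open>auto simp: decidable_def intro: computable_nth computable_hd\<close>)
  moreover have "map (\<lambda>i. ns ! (i + 2)) [0..<k] = tl (tl ns)"
    if "length ns = Suc (Suc k)" for ns :: "nat list"
    using that by (intro nth_equalityI) (auto simp: nth_tl)
  ultimately have P': "computable (Suc (Suc k)) (\<lambda>x ns. of_bool (P x (hd ns) (tl (tl ns))))"
    by (elim computable_cong) (simp add: comp_def)
  have "decidable k (\<lambda>x ns. 0 < rec_nat (0::nat) (\<lambda>n q. q + of_bool (P x n ns)) (N x ns))"
    by (intro comp_intros N P') simp
  then show ?thesis unfolding rec .
qed

lemma decidable_ball [comp_intros]:
  assumes "decidable (Suc k) (\<lambda>x ns. P x (hd ns) (tl ns))" "computable k N"
  shows "decidable k (\<lambda>x ns. \<forall>m<N x ns. P x m ns)"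
  using decidable_not[OF decidable_bex[OF decidable_not[OF assms(1)] assms(2)]] by simp

lemma computable_of_bool [comp_intros]:
  "decidable k P \<Longrightarrow> computable k (\<lambda>x ns. of_bool (P x ns))"
  unfolding decidable_def .

text \<open>\<open>Mu\<close> looks for a zero, so it is applied to the characteristic function of
  the negation; \<open>ex\<close> makes the search halt.\<close>

lemma computable_Least:
  assumes P: "decidable (Suc k) (\<lambda>x ns. P x (hd ns) (tl ns))"
    and ex: "\<And>x ns. length ns = k \<Longrightarrow> \<exists>m. P x m ns"
  shows "computable k (\<lambda>x ns. LEAST m. P x m ns)"
proof -
  from decidable_not[OF P] obtain e where
    e: "\<And>x ns. length ns = Suc k \<Longrightarrow> rec_eval x e ns (of_bool (\<not> P x (hd ns) (tl ns)))"
    unfolding decidable_def computable_def by blast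
  have "rec_eval x (Mu e) ns (LEAST m. P x m ns)" if len: "length ns = k" for x ns
  proof (rule rec_eval_Mu)
    have "P x (LEAST m. P x m ns) ns" using ex[OF len] by (rule LeastI_ex)
    then show "rec_eval x e ((LEAST m. P x m ns) # ns) 0"
      using e[of "(LEAST m. P x m ns) # ns" x] len by simp
    show "\<forall>m<LEAST m. P x m ns. \<exists>v>0. rec_eval x e (m # ns) v"
    proof (intro allI impI)
      fix m assume "m < (LEAST m. P x m ns)"
      then have "\<not> P x m ns" by (rule not_less_Least)
      then show "\<exists>v>0. rec_eval x e (m # ns) v" using e[of "m # ns" x] len by auto
    qed
  qed
  then show ?thesis unfolding computable_def by blast
qed

text \<open>The quotient is the least \<open>q\<close> with \<open>a < b * Suc q\<close>; the
  disjunct \<open>b = 0\<close> stops the search at 0, the value of division by 0.\<close>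

lemma computable_div [comp_intros]:
  assumes "computable k A" "computable k B"
  shows "computable k (\<lambda>x ns. A x ns div B x ns)"
proof (rule computable_compose2[OF _ assms])
  have "(LEAST q. b = 0 \<or> a < b * Suc q) = a div b" for a b :: nat
  proof (rule Least_equality)
    show "b = 0 \<or> a < b * Suc (a div b)" using dividend_less_times_div[of b a] by auto
    show "a div b \<le> q" if "b = 0 \<or> a < b * Suc q" for q
    proof (cases "b = 0")
      case False
      with that have "a < Suc q * b" by (simp add: mult.commute)
      then have "a div b < Suc q" by (rule less_mult_imp_div_less)
      then show ?thesis by simp
    qed simp
  qed
  moreover have "computable 2 (\<lambda>x ns. LEAST q. hd (tl ns) = 0 \<or> hd ns < hd (tl ns) * Suc q)"
  proof (rule computable_Least)
    show "\<exists>q. hd (tl ns) = 0 \<or> hd ns < hd (tl ns) * Suc q" for ns :: "nat list"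
      using dividend_less_times_div[of "hd (tl ns)" "hd ns"] by (metis gr_zeroI mult_Suc_right)
  qed (intro comp_intros; simp)
  ultimately show "computable 2 (\<lambda>x ns. hd ns div hd (tl ns))" by simp
qed

lemma computable_mod [comp_intros]:
  assumes "computable k A" "computable k B"
  shows "computable k (\<lambda>x ns. A x ns mod B x ns)"
proof -
  have "computable k (\<lambda>x ns. A x ns - B x ns * (A x ns div B x ns))"
    by (intro comp_intros assms)
  then show ?thesis unfolding minus_mult_div_eq_mod .
qed

lemma decidable_odd [comp_intros]:
  assumes "computable k A"
  shows "decidable k (\<lambda>x ns. odd (A x ns))"
  unfolding odd_iff_mod_2_eq_one by (intro comp_intros assms)

lemma computable_prod_encode [comp_intros]:
  assumes "computable k A" "computable k B"
  shows "computable k (\<lambda>x ns. prod_encode (A x ns, B x ns))"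
  unfolding prod_encode_def triangle_def split by (intro comp_intros assms)

text \<open>Both components are at most the code, so one is searched for while a bounded quantifier
  ranges over the other.\<close>

lemma computable_prod_decode [comp_intros]:
  assumes A: "computable k A"
  shows "computable k (\<lambda>x ns. fst (prod_decode (A x ns)))"
    and "computable k (\<lambda>x ns. snd (prod_decode (A x ns)))"
proof -
  have ex: "\<exists>b<Suc n. prod_encode (fst (prod_decode n), b) = n"
    "\<exists>a<Suc n. prod_encode (a, snd (prod_decode n)) = n" for n
    by (metis le_imp_less_Suc le_prod_encode_1 le_prod_encode_2 prod.collapse prod_decode_inverse)+
  have "(LEAST a. \<exists>b<Suc n. prod_encode (a, b) = n) = fst (prod_decode n)" for n
    by (rule Least_equality) (use ex(1)[of n] in auto)
  moreover have "computable 1 (\<lambda>x ns. LEAST a. \<exists>b<Suc (hd ns). prod_encode (a, b) = hd ns)"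
  proof (rule computable_Least)
    show "\<exists>a. \<exists>b<Suc (hd ns). prod_encode (a, b) = hd ns" for ns :: "nat list" using ex by blast
  qed (intro comp_intros; simp)
  ultimately show "computable k (\<lambda>x ns. fst (prod_decode (A x ns)))"
    by (intro computable_compose1[OF _ A]) simp
  have "(LEAST b. \<exists>a<Suc n. prod_encode (a, b) = n) = snd (prod_decode n)" for n
    by (rule Least_equality) (use ex(2)[of n] in auto)
  moreover have "computable 1 (\<lambda>x ns. LEAST b. \<exists>a<Suc (hd ns). prod_encode (a, b) = hd ns)"
  proof (rule computable_Least)
    show "\<exists>b. \<exists>a<Suc (hd ns). prod_encode (a, b) = hd ns" for ns :: "nat list" using ex by blast
  qed (intro comp_intros; simp)
  ultimately show "computable k (\<lambda>x ns. snd (prod_decode (A x ns)))"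
    by (intro computable_compose1[OF _ A]) simp
qed

lemma turing_functional_of_computable:
  assumes "computable 1 (\<lambda>x ns. F x (hd ns))"
  obtains e where "\<And>x. turing_functional e x (F x)"
  using assms unfolding computable_def turing_functional_def
  by (metis length_Cons list.sel(1) list.size(3) One_nat_def)

section \<open>Strings as numbers\<close>

abbreviation str :: "nat \<Rightarrow> bool list" where "str \<equiv> inv str_code"

lemma str_str_code [simp]: "str (str_code \<sigma>) = \<sigma>"
  by (simp add: bij_str_code bij_is_inj)

lemma str_code_str [simp]: "str_code (str n) = n"
  by (simp add: bij_str_code bij_is_surj surj_f_inv_f)

lemma coloring_code_str_code [simp]: "coloring_code f (str_code \<tau>) = of_bool (f \<tau>)"
  by (simp add: coloring_code_def)

text \<open>\<open>Suc (str_code \<sigma>)\<close> has the binary digits 1 followed by \<sigma>, so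
  division by powers of 2 removes bits from the end.\<close>

lemma Suc_str_code_append: "Suc (str_code (\<sigma> @ \<rho>)) div 2 ^ length \<rho> = Suc (str_code \<sigma>)"
proof (induction \<rho> rule: rev_induct)
  case (snoc b \<rho>)
  have "Suc (str_code (\<sigma> @ \<rho> @ [b])) div 2 = Suc (str_code (\<sigma> @ \<rho>))"
    using str_code_snoc[of "\<sigma> @ \<rho>" b] by simp
  with snoc show ?case by (simp add: div_mult2_eq)
qed simp

lemma str_code_bounds: "2 ^ length \<sigma> \<le> Suc (str_code \<sigma>)" "Suc (str_code \<sigma>) < 2 ^ Suc (length \<sigma>)"
  by (induction \<sigma> rule: rev_induct) (auto split: if_splits)

lemma length_le_str_code: "length \<sigma> \<le> str_code \<sigma>"
  by (induction \<sigma> rule: rev_induct) auto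

lemma str_code_mono: "prefix \<sigma> \<tau> \<Longrightarrow> str_code \<sigma> \<le> str_code \<tau>"
proof (induction \<tau> rule: rev_induct)
  case (snoc b \<tau>)
  then show ?case by (cases "\<sigma> = \<tau> @ [b]") (auto simp: less_imp_le)
qed simp

lemma prefix_str_iff: "prefix (str m) (str n) \<longleftrightarrow> (\<exists>k<Suc n. Suc n div 2 ^ k = Suc m)"
proof
  assume "prefix (str m) (str n)"
  then obtain \<rho> where \<rho>: "str n = str m @ \<rho>" by (auto simp: prefix_def)
  then have n: "n = str_code (str m @ \<rho>)" by (metis str_code_str)
  have "length \<rho> < Suc n" using length_le_str_code[of "str n"] unfolding str_code_str by (simp add: \<rho>)
  moreover have "Suc n div 2 ^ length \<rho> = Suc m"
    using Suc_str_code_append[of "str m" \<rho>] n by simp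
  ultimately show "\<exists>k<Suc n. Suc n div 2 ^ k = Suc m" by blast
next
  assume "\<exists>k<Suc n. Suc n div 2 ^ k = Suc m"
  then obtain k where k: "Suc n div 2 ^ k = Suc m" by blast
  have "k \<le> length (str n)"
  proof (rule ccontr)
    assume "\<not> k \<le> length (str n)"
    then have "(2::nat) ^ Suc (length (str n)) \<le> 2 ^ k" by (intro power_increasing) auto
    then have "Suc n < 2 ^ k" using str_code_bounds(2)[of "str n"] by simp
    with k show False by simp
  qed
  then have "Suc n div 2 ^ k = Suc (str_code (take (length (str n) - k) (str n)))"
    using Suc_str_code_append[of "take (length (str n) - k) (str n)" "drop (length (str n) - k) (str n)"]
    by simp
  with k have "str m = take (length (str n) - k) (str n)" by (metis nat.inject str_str_code)
  then show "prefix (str m) (str n)" by (simp add: take_is_prefix)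
qed

lemma decidable_prefix [comp_intros]:
  assumes "computable k A" "computable k B"
  shows "decidable k (\<lambda>x ns. prefix (str (A x ns)) (str (B x ns)))"
proof -
  have "computable 2 (\<lambda>x ns. of_bool (\<exists>k<Suc (hd (tl ns)). Suc (hd (tl ns)) div 2 ^ k = Suc (hd ns)))"
    by (intro comp_intros) simp_all
  then have "computable 2 (\<lambda>x ns. of_bool (prefix (str (hd ns)) (str (hd (tl ns)))))"
    unfolding prefix_str_iff .
  from computable_compose2[OF this assms] show ?thesis unfolding decidable_def .
qed

lemma length_str: "length (str n) = (LEAST l. Suc n < 2 ^ Suc l)"
proof (rule Least_equality[symmetric])
  show "Suc n < 2 ^ Suc (length (str n))" using str_code_bounds(2)[of "str n"] by simp
  show "length (str n) \<le> l" if "Suc n < 2 ^ Suc l" for l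
  proof -
    have "(2::nat) ^ length (str n) < 2 ^ Suc l"
      using str_code_bounds(1)[of "str n"] that by simp
    then show ?thesis by (simp only: power_strict_increasing_iff[of "2::nat"] less_Suc_eq_le)
  qed
qed

lemma computable_length_str [comp_intros]:
  assumes "computable k A"
  shows "computable k (\<lambda>x ns. length (str (A x ns)))"
proof (rule computable_compose1[OF _ assms])
  have "computable 1 (\<lambda>x ns. LEAST l. Suc (hd ns) < 2 ^ Suc l)"
  proof (rule computable_Least)
    show "\<exists>l. Suc (hd ns) < 2 ^ Suc l" for ns
      using str_code_bounds(2)[of "str (hd ns)"] by auto
  qed (intro comp_intros; simp)
  then show "computable 1 (\<lambda>x ns. length (str (hd ns)))" unfolding length_str .
qed

definition bit_at :: "bool list \<Rightarrow> nat \<Rightarrow> bool" where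
  "bit_at \<tau> u \<longleftrightarrow> u < length \<tau> \<and> \<tau> ! u"

text \<open>\<open>2 * m + 2\<close> codes \<open>str m\<close> followed by 1, so indexing becomes a
  bounded search for the prefix in front of the bit.\<close>

lemma bit_at_str_iff:
  "bit_at (str n) u \<longleftrightarrow> (\<exists>m<n. length (str m) = u \<and> prefix (str (2 * m + 2)) (str n))"
proof -
  have snoc: "str (2 * m + 2) = str m @ [True]" for m
    by (metis add.assoc of_bool_eq(2) one_add_one str_code_snoc str_code_str str_str_code)
  show ?thesis
  proof
    assume b: "bit_at (str n) u"
    let ?m = "str_code (take u (str n))"
    have p: "prefix (take u (str n) @ [True]) (str n)"
      using b by (metis bit_at_def take_Suc_conv_app_nth take_is_prefix)
    then have "str_code (take u (str n) @ [True]) \<le> n" using str_code_mono by fastforce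
    then have "?m < n" by simp
    moreover have "length (str ?m) = u" using b by (simp add: bit_at_def)
    ultimately show "\<exists>m<n. length (str m) = u \<and> prefix (str (2 * m + 2)) (str n)"
      using p snoc by (metis str_str_code)
  next
    assume "\<exists>m<n. length (str m) = u \<and> prefix (str (2 * m + 2)) (str n)"
    then show "bit_at (str n) u" unfolding snoc by (auto simp: bit_at_def prefix_def)
  qed
qed

lemma decidable_bit_at [comp_intros]:
  assumes "computable k A" "computable k B"
  shows "decidable k (\<lambda>x ns. bit_at (str (A x ns)) (B x ns))"
proof -
  have "computable 2 (\<lambda>x ns. of_bool (\<exists>m<hd ns. length (str m) = hd (tl ns) \<and>
      prefix (str (2 * m + 2)) (str (hd ns))))"
    by (intro comp_intros) simp_all
  then have "computable 2 (\<lambda>x ns. of_bool (bit_at (str (hd ns)) (hd (tl ns))))"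
    unfolding bit_at_str_iff .
  from computable_compose2[OF this assms] show ?thesis unfolding decidable_def .
qed

section \<open>Reductions between colouring problems\<close>

lemma inst_coloring_problem: "inst (coloring_problem c S) = range coloring_code"
  by (simp add: coloring_problem_def)

lemma join_simps [simp]:
  "(x \<oplus> y) (2 * n) = x n" "(x \<oplus> y) (Suc (2 * n)) = y n" "(x \<oplus> y) (Suc 0) = y 0"
  by (simp_all add: join_def)

text \<open>Total functionals suffice for all reductions to be constructed, so definedness needs no
  separate care.\<close>

lemma coloring_problem_leI:
  assumes \<Phi>: "computable 1 (\<lambda>x ns. \<Phi> x (hd ns))" and \<Psi>: "computable 1 (\<lambda>x ns. \<Psi> x (hd ns))"
    and sound: "\<And>f. \<exists>g. \<Phi> (coloring_code f) = coloring_code g \<and>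
      (\<forall>t\<in>T g. \<exists>s\<in>S f. \<Psi> (coloring_code f \<oplus> d t) = c s)"
  shows "coloring_problem c S \<le>\<^sub>W coloring_problem d T"
proof -
  obtain e where e: "\<And>x. turing_functional e x (\<Phi> x)"
    using turing_functional_of_computable[OF \<Phi>] by blast
  obtain e' where e': "\<And>x. turing_functional e' x (\<Psi> x)"
    using turing_functional_of_computable[OF \<Psi>] by blast
  show ?thesis
    unfolding weihrauch_le_def inst_coloring_problem
  proof (rule exI[of _ e], rule exI[of _ e'], rule ballI)
    fix x assume "x \<in> range coloring_code"
    then obtain f where f: "x = coloring_code f" by blast
    obtain g where g: "\<Phi> x = coloring_code g"
      "\<And>t. t \<in> T g \<Longrightarrow> \<exists>s\<in>S f. \<Psi> (x \<oplus> d t) = c s"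
      using sound f by blast
    have "turing_functional e x (coloring_code g)" using e g(1) by metis
    moreover have "\<forall>y\<in>sol (coloring_problem d T) (coloring_code g).
        \<exists>w. turing_functional e' (x \<oplus> y) w \<and> w \<in> sol (coloring_problem c S) x"
      unfolding f sol_coloring_problem using g(2) e' f by force
    ultimately show "\<exists>z. turing_functional e x z \<and> z \<in> range coloring_code \<and>
        (\<forall>y\<in>sol (coloring_problem d T) z.
          \<exists>w. turing_functional e' (x \<oplus> y) w \<and> w \<in> sol (coloring_problem c S) x)"
      by blast
  qed
qed

text \<open>The forward functional is the identity and the backward one returns the second half of
  the join.\<close>

lemma coloring_problem_le_mono:
  assumes "\<And>f. T f \<subseteq> S f"
  shows "coloring_problem c S \<le>\<^sub>W coloring_problem c T"
proof (rule coloring_problem_leI[where \<Phi> = "\<lambda>x. x" and \<Psi> = "\<lambda>x n. x (Suc (2 * n))"])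
  show "\<exists>g. coloring_code f = coloring_code g \<and>
      (\<forall>t\<in>T g. \<exists>s\<in>S f. (\<lambda>n. (coloring_code f \<oplus> c t) (Suc (2 * n))) = c s)" for f
    using assms by (intro exI[of _ f]) auto
qed (intro comp_intros; simp)+

lemma weihrauch_le_mono_right:
  assumes "P \<le>\<^sub>W coloring_problem d T" "\<And>f. T' f \<subseteq> T f"
  shows "P \<le>\<^sub>W coloring_problem d T'"
proof -
  have "sol (coloring_problem d T') z \<subseteq> sol (coloring_problem d T) z" for z
    using assms(2) by (auto simp: coloring_problem_def)
  then show ?thesis
    using assms(1) unfolding weihrauch_le_def inst_coloring_problem by (meson subsetD)
qed

lemma weihrauch_le_mono_left:
  assumes "coloring_problem c S \<le>\<^sub>W Q" "\<And>f. S f \<subseteq> S' f"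
  shows "coloring_problem c S' \<le>\<^sub>W Q"
proof -
  have "sol (coloring_problem c S) z \<subseteq> sol (coloring_problem c S') z" for z
    using assms(2) by (auto simp: coloring_problem_def)
  then show ?thesis
    using assms(1) unfolding weihrauch_le_def inst_coloring_problem by (meson subsetD)
qed

section \<open>Guesses with finitely many changes\<close>

text \<open>\<open>R n s\<close> is read as: guess \<open>n\<close> is refuted by stage
  \<open>s\<close>. The current guess is the least one still standing.\<close>

definition settle :: "(nat \<Rightarrow> nat \<Rightarrow> bool) \<Rightarrow> nat \<Rightarrow> nat" where
  "settle R s = (LEAST n. \<not> R n s)"

text \<open>A move at \<open>s\<close> shows in the guess only from stage \<open>Suc s\<close> on,
  so the final guess is reached at any stage strictly above all moves.\<close>

definition moves :: "(nat \<Rightarrow> nat \<Rightarrow> bool) \<Rightarrow> nat set" where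
  "moves R = {s. settle R (Suc s) \<noteq> settle R s}"

locale refutation =
  fixes R :: "nat \<Rightarrow> nat \<Rightarrow> bool"
  assumes R_mono: "R n s \<Longrightarrow> s \<le> t \<Longrightarrow> R n t"
    and R_ex: "\<exists>n. \<not> R n s"
begin

lemma not_R_settle: "\<not> R (settle R s) s"
  unfolding settle_def using R_ex by (rule LeastI_ex)

lemma settle_le: "\<not> R n s \<Longrightarrow> settle R s \<le> n"
  unfolding settle_def by (rule Least_le)

lemma settle_mono: "s \<le> t \<Longrightarrow> settle R s \<le> settle R t"
  using not_R_settle R_mono by (blast intro: settle_le)

lemma settle_stable: "s \<le> t \<Longrightarrow> \<forall>u\<in>moves R. u < s \<Longrightarrow> settle R t = settle R s"
proof (induction rule: dec_induct)
  case (step t)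
  then have "t \<notin> moves R" by auto
  with step show ?case by (simp add: moves_def)
qed simp

text \<open>A refutation at \<open>t\<close> would persist to \<open>max s t\<close>, where the
  guess is still the same and current guesses are unrefuted.\<close>

lemma not_R_settle_final:
  assumes "\<forall>u\<in>moves R. u < s"
  shows "\<not> R (settle R s) t"
proof
  assume "R (settle R s) t"
  then have "R (settle R s) (max s t)" by (rule R_mono) simp
  moreover have "settle R (max s t) = settle R s" using assms by (intro settle_stable) auto
  ultimately show False using not_R_settle by metis
qed

text \<open>A guess that is never refuted bounds all current guesses, but the current guess grows at
  every move.\<close>

lemma infinite_movesD:
  assumes "infinite (moves R)"
  shows "\<exists>s. R n s"
proof (rule ccontr)
  assume "\<nexists>s. R n s"
  then have "settle R ` moves R \<subseteq> {..n}" by (auto intro: settle_le)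
  then have "finite (settle R ` moves R)" by (rule finite_subset) simp
  moreover have "inj_on (settle R) (moves R)"
  proof (rule linorder_inj_onI)
    fix s t assume "s < t" "s \<in> moves R"
    then have "settle R s < settle R (Suc s)" "settle R (Suc s) \<le> settle R t"
      using settle_mono[of s "Suc s"] settle_mono[of "Suc s" t] by (auto simp: moves_def)
    then show "settle R s \<noteq> settle R t" by simp
  qed auto
  ultimately show False using assms finite_imageD by blast
qed

end

lemma computable_settle:
  assumes R: "decidable 2 (\<lambda>x ns. R x (hd ns) (hd (tl ns)))" and ex: "\<And>x s. \<exists>n. \<not> R x n s"
    and A: "computable k A"
  shows "computable k (\<lambda>x ns. settle (R x) (A x ns))"
proof (rule computable_compose1[OF _ A])
  have "computable 1 (\<lambda>x ns. LEAST n. \<not> R x n (hd ns))"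
    by (rule computable_Least) (use ex decidable_not[OF R] in \<open>simp_all add: numeral_2_eq_2\<close>)
  then show "computable 1 (\<lambda>x ns. settle (R x) (hd ns))" unfolding settle_def .
qed

lemma decidable_moves:
  assumes "decidable 2 (\<lambda>x ns. R x (hd ns) (hd (tl ns)))" "\<And>x s. \<exists>n. \<not> R x n s"
    "computable k A"
  shows "decidable k (\<lambda>x ns. A x ns \<in> moves (R x))"
  unfolding moves_def mem_Collect_eq by (intro comp_intros computable_settle assms)

text \<open>
  The number \<open>n\<close> stands for the guess that the colour is constantly \<open>n mod 2\<close> above the string
  \<open>n div 2\<close>; the guess is refuted at stage \<open>s\<close> by a counterexample with code below \<open>s\<close>.
\<close>

definition refuted :: "baire \<Rightarrow> nat \<Rightarrow> nat \<Rightarrow> bool" where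
  "refuted x n s \<longleftrightarrow> (\<exists>m<s. prefix (str (n div 2)) (str m) \<and> x m \<noteq> n mod 2)"

lemma refuted_coloring_code_iff:
  "(\<exists>s. refuted (coloring_code f) n s) \<longleftrightarrow> (\<exists>\<tau>. prefix (str (n div 2)) \<tau> \<and> f \<tau> \<noteq> odd n)"
proof -
  have "coloring_code f m \<noteq> n mod 2 \<longleftrightarrow> f (str m) \<noteq> odd n" for m
    by (auto simp: coloring_code_def odd_iff_mod_2_eq_one)
  then have "(\<exists>s. refuted (coloring_code f) n s) \<longleftrightarrow>
      (\<exists>m. prefix (str (n div 2)) (str m) \<and> f (str m) \<noteq> odd n)"
    unfolding refuted_def by blast
  then show ?thesis by (metis str_str_code)
qed

lemma refuted_mono: "refuted x n s \<Longrightarrow> s \<le> t \<Longrightarrow> refuted x n t"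
  unfolding refuted_def by (meson less_le_trans)

text \<open>A counterexample extends \<open>str (n div 2)\<close>, so its code is at least
  \<open>n div 2\<close>. Hence at each stage some guess, even some odd one, is left.\<close>

lemma not_refuted_early: "s \<le> n div 2 \<Longrightarrow> \<not> refuted x n s"
proof
  assume "s \<le> n div 2" "refuted x n s"
  then obtain m where "m < n div 2" "prefix (str (n div 2)) (str m)"
    unfolding refuted_def by (meson less_le_trans)
  then show False using str_code_mono by fastforce
qed

lemma ex_not_refuted: "\<exists>n. \<not> refuted x n s" "\<exists>n. \<not> refuted x (Suc (2 * n)) s"
  using not_refuted_early[of s "Suc (2 * s)" x] by auto

interpretation refuted: refutation "refuted x" for x
  by unfold_locales (auto intro: refuted_mono ex_not_refuted)

text \<open>An odd guess stands for a cone of colour 1, and its half is the code of the root; V4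
  asks for cones of this colour only.\<close>

interpretation refuted_odd: refutation "\<lambda>n. refuted x (Suc (2 * n))" for x
  by unfold_locales (auto intro: refuted_mono ex_not_refuted)

lemma decidable_refuted [comp_intros]:
  assumes "computable k A" "computable k B"
  shows "decidable k (\<lambda>x ns. refuted x (A x ns) (B x ns))"
    and "decidable k (\<lambda>x ns. refuted (\<lambda>n. x (2 * n)) (A x ns) (B x ns))"
proof -
  have "computable 2 (\<lambda>x ns. of_bool (refuted x (hd ns) (hd (tl ns))))"
    unfolding refuted_def by (intro comp_intros) simp_all
  from computable_compose2[OF this assms]
  show "decidable k (\<lambda>x ns. refuted x (A x ns) (B x ns))" unfolding decidable_def .
  have "computable 2 (\<lambda>x ns. of_bool (refuted (\<lambda>n. x (2 * n)) (hd ns) (hd (tl ns))))"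
    unfolding refuted_def by (intro comp_intros) simp_all
  from computable_compose2[OF this assms]
  show "decidable k (\<lambda>x ns. refuted (\<lambda>n. x (2 * n)) (A x ns) (B x ns))" unfolding decidable_def .
qed

section \<open>Colourings given by sets of stages\<close>

text \<open>
  In both colourings \<open>S\<close> is the set of stages at which a guess changes. If \<open>u\<close> is the last such
  stage, then above a string of length at most \<open>u\<close> neither colour of \<open>last_bit S\<close> is dense, and
  the colour 1 of \<open>all_bits S\<close> is not dense, so a solution must be longer than \<open>u\<close> and
  thereby knows the final guess. With infinitely many changes, every solution for \<open>all_bits S\<close>
  has colour 0.
\<close>

definition last_bit :: "nat set \<Rightarrow> bool list \<Rightarrow> bool" where
  "last_bit S \<tau> \<longleftrightarrow> (\<exists>u<length \<tau>. bit_at \<tau> u \<and> u \<in> S \<and> (\<forall>t<length \<tau>. t \<in> S \<longrightarrow> t \<le> u))"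

definition all_bits :: "nat set \<Rightarrow> bool list \<Rightarrow> bool" where
  "all_bits S \<tau> \<longleftrightarrow> (\<forall>u<length \<tau>. u \<in> S \<longrightarrow> bit_at \<tau> u)"

text \<open>Padding moves the free bit \<open>b\<close> to position \<open>u\<close>, so a string of
  length at most \<open>u\<close> can be extended with either bit there.\<close>

lemma bit_at_append_replicate:
  assumes "length \<sigma> \<le> u" "prefix (\<sigma> @ replicate (u - length \<sigma>) False @ [b]) \<tau>"
  shows "u < length \<tau>" "bit_at \<tau> u \<longleftrightarrow> b"
  using assms by (auto simp: prefix_def bit_at_def nth_append)

text \<open>Every string longer than the largest stage \<open>u\<close> has its bit at
  \<open>u\<close> as colour, and an extension with bit \<open>\<not> i\<close> there excludes
  colour \<open>i\<close>.\<close>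

lemma last_bit_not_dense_above:
  assumes "u \<in> S" "\<forall>t\<in>S. t \<le> u" "length \<sigma> \<le> u"
  shows "\<not> dense_above {\<tau>. last_bit S \<tau> = i} \<sigma>"
proof
  let ?\<rho> = "\<sigma> @ replicate (u - length \<sigma>) False @ [\<not> i]"
  assume "dense_above {\<tau>. last_bit S \<tau> = i} \<sigma>"
  moreover have "prefix \<sigma> ?\<rho>" by simp
  ultimately obtain \<tau> where \<tau>: "last_bit S \<tau> = i" "prefix ?\<rho> \<tau>"
    unfolding dense_above_def by blast
  note bit = bit_at_append_replicate[OF assms(3) \<tau>(2)]
  have "last_bit S \<tau> = bit_at \<tau> u"
    unfolding last_bit_def using assms(1,2) bit(1) by (auto dest!: le_antisym)
  with bit(2) \<tau>(1) show False by simp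
qed

lemma last_bit_dense_above_length:
  assumes "finite S" "dense_above {\<tau>. last_bit S \<tau> = i} \<sigma>" "t \<in> S"
  shows "t < length \<sigma>"
proof (rule ccontr)
  assume "\<not> t < length \<sigma>"
  then have "length \<sigma> \<le> Max S" using Max_ge[OF assms(1,3)] by linarith
  then have "\<not> dense_above {\<tau>. last_bit S \<tau> = i} \<sigma>"
    using assms(1,3) by (intro last_bit_not_dense_above[of "Max S"]) (auto intro: Max_in)
  with assms(2) show False by contradiction
qed

text \<open>Once the bit at a stage is 0, all further extensions have colour 0.\<close>

lemma all_bits_dense_above_length:
  assumes "dense_above {\<tau>. all_bits S \<tau> = True} \<sigma>" "t \<in> S"
  shows "t < length \<sigma>"
proof (rule ccontr)
  let ?\<rho> = "\<sigma> @ replicate (t - length \<sigma>) False @ [False]"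
  assume "\<not> t < length \<sigma>"
  then have t: "length \<sigma> \<le> t" by simp
  have "prefix \<sigma> ?\<rho>" by simp
  with assms(1) obtain \<tau> where \<tau>: "all_bits S \<tau>" "prefix ?\<rho> \<tau>"
    unfolding dense_above_def by blast
  from bit_at_append_replicate[OF t \<tau>(2)] \<tau>(1) assms(2) show False by (auto simp: all_bits_def)
qed

lemma all_bits_not_dense_above: "infinite S \<Longrightarrow> \<not> dense_above {\<tau>. all_bits S \<tau> = True} \<sigma>"
  using all_bits_dense_above_length by (meson finite_lessThan finite_subset lessThan_iff subsetI)

lemma all_bits_not_dense_str:
  assumes "finite S"
  shows "\<not> dense_str {\<tau>. all_bits S \<tau> = False}"
proof
  assume "dense_str {\<tau>. all_bits S \<tau> = False}"
  \<comment> \<open>Enough ones cover every stage of \<open>S\<close>, so no extension can have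
    colour 0.\<close>
  then obtain \<tau> where \<tau>: "\<not> all_bits S \<tau>" "prefix (replicate (Suc (Max S)) True) \<tau>"
    unfolding dense_above_def by auto
  have "bit_at \<tau> u" if "u \<in> S" for u
  proof -
    have "u < Suc (Max S)" using that assms by (simp add: less_Suc_eq_le)
    with \<tau>(2) show ?thesis
      by (auto simp: prefix_def bit_at_def nth_append simp del: replicate_Suc)
  qed
  with \<tau>(1) show False by (auto simp: all_bits_def)
qed

section \<open>Reductions that read off a final guess\<close>

lemma V1_le_V0: "V1 \<le>\<^sub>W V0"
  unfolding V1_def V0_def
\<comment> \<open>\<open>z 1\<close> is the first value of the solution. Only the length of its
  string is used, as the stage at which the guess is read; \<open>c\<close> encodes colour and root
  of the guessed cone.\<close>
proof (rule coloring_problem_leI[where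
      \<Phi> = "\<lambda>x n. of_bool (last_bit (moves (refuted x)) (str n))" and
      \<Psi> = "\<lambda>z n. let c = settle (refuted (\<lambda>n. z (2 * n))) (length (str (snd (prod_decode (z 1)))))
        in prod_encode (c mod 2, c div 2)"])
  show "computable 1 (\<lambda>x ns. of_bool (last_bit (moves (refuted x)) (str (hd ns))))"
    unfolding last_bit_def
    by (intro comp_intros decidable_moves ex_not_refuted) simp_all
  show "computable 1 (\<lambda>x ns. let c = settle (refuted (\<lambda>n. x (2 * n))) (length (str (snd (prod_decode (x 1)))))
        in prod_encode (c mod 2, c div 2))"
    unfolding Let_def by (intro comp_intros computable_settle[where R = "\<lambda>x. refuted (\<lambda>n. x (2 * n))"] ex_not_refuted) simp_all
  fix f
  let ?S = "moves (refuted (coloring_code f))"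
  show "\<exists>g. (\<lambda>n. of_bool (last_bit ?S (str n))) = coloring_code g \<and>
      (\<forall>t\<in>{(i, \<sigma>). dense_above {\<tau>. g \<tau> = i} \<sigma>}.
        \<exists>s\<in>{(i, \<sigma>). dense_str {\<tau>. f \<tau> = False} \<and> dense_str {\<tau>. f \<tau> = True} \<or>
            (\<forall>\<tau>. prefix \<sigma> \<tau> \<longrightarrow> f \<tau> = i)}.
          (\<lambda>n. let c = settle (refuted (\<lambda>n. (coloring_code f \<oplus> pair_code t) (2 * n)))
              (length (str (snd (prod_decode ((coloring_code f \<oplus> pair_code t) 1)))))
            in prod_encode (c mod 2, c div 2)) = pair_code s)"
    (is "\<exists>g. _ \<and> (\<forall>t\<in>?T g. \<exists>s\<in>?Sol. _)")
  proof (intro exI[of _ "last_bit ?S"] conjI ballI)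
    show "(\<lambda>n. of_bool (last_bit ?S (str n))) = coloring_code (last_bit ?S)"
      by (simp add: coloring_code_def fun_eq_iff)
    fix t assume "t \<in> ?T (last_bit ?S)"
    then obtain i \<sigma> where t: "t = (i, \<sigma>)" and dense: "dense_above {\<tau>. last_bit ?S \<tau> = i} \<sigma>" by blast
    define c where "c = settle (refuted (coloring_code f)) (length \<sigma>)"
    have "(odd c, str (c div 2)) \<in> ?Sol"
    proof (cases "finite ?S")
      case True
      then have "\<forall>u\<in>?S. u < length \<sigma>" using last_bit_dense_above_length[OF _ dense] by blast
      from refuted.not_R_settle_final[OF this]
      have "\<not> (\<exists>s. refuted (coloring_code f) c s)" by (simp add: c_def)
      then show ?thesis unfolding refuted_coloring_code_iff by simp
    next
      case False
      \<comment> \<open>The number \<open>2 * str_code \<rho> + of_bool b\<close> is the guess of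
        colour \<open>b\<close> above \<rho>; each such guess is refuted.\<close>
      have "\<exists>\<tau>. prefix \<rho> \<tau> \<and> f \<tau> \<noteq> b" for \<rho> b
        using refuted.infinite_movesD[OF False, of "2 * str_code \<rho> + of_bool b"]
        unfolding refuted_coloring_code_iff by (auto split: if_splits)
      then have "dense_str {\<tau>. f \<tau> = False} \<and> dense_str {\<tau>. f \<tau> = True}"
        unfolding dense_above_def by (metis (full_types) mem_Collect_eq)
      then show ?thesis by blast
    qed
    moreover have "(\<lambda>n. let c = settle (refuted (\<lambda>n. (coloring_code f \<oplus> pair_code t) (2 * n)))
              (length (str (snd (prod_decode ((coloring_code f \<oplus> pair_code t) 1)))))
            in prod_encode (c mod 2, c div 2)) = pair_code (odd c, str (c div 2))"
      by (simp add: t pair_code_def c_def Let_def fun_eq_iff odd_iff_mod_2_eq_one mod2_eq_if)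
    ultimately show "\<exists>s\<in>?Sol. (\<lambda>n. let c = settle (refuted (\<lambda>n. (coloring_code f \<oplus> pair_code t) (2 * n)))
              (length (str (snd (prod_decode ((coloring_code f \<oplus> pair_code t) 1)))))
            in prod_encode (c mod 2, c div 2)) = pair_code s" by blast
  qed
qed

text \<open>The colour of the solution is kept, and its string is replaced by the root guessed at
  the stage given by its length.\<close>

lemma V4_le_V2: "V4 \<le>\<^sub>W V2"
  unfolding V4_def V2_def
proof (rule coloring_problem_leI[where
      \<Phi> = "\<lambda>x n. of_bool (all_bits (moves (\<lambda>n. refuted x (Suc (2 * n)))) (str n))" and
      \<Psi> = "\<lambda>z n. prod_encode (fst (prod_decode (z 1)),
        settle (\<lambda>n. refuted (\<lambda>n. z (2 * n)) (Suc (2 * n))) (length (str (snd (prod_decode (z 1))))))"])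
  show "computable 1 (\<lambda>x ns. of_bool (all_bits (moves (\<lambda>n. refuted x (Suc (2 * n)))) (str (hd ns))))"
    unfolding all_bits_def
    by (intro comp_intros decidable_moves ex_not_refuted) simp_all
  show "computable 1 (\<lambda>x ns. prod_encode (fst (prod_decode (x 1)),
      settle (\<lambda>n. refuted (\<lambda>n. x (2 * n)) (Suc (2 * n))) (length (str (snd (prod_decode (x 1)))))))"
    by (intro comp_intros ex_not_refuted
        computable_settle[where R = "\<lambda>x n. refuted (\<lambda>n. x (2 * n)) (Suc (2 * n))"]) simp_all
  fix f
  let ?S = "moves (\<lambda>n. refuted (coloring_code f) (Suc (2 * n)))"
  show "\<exists>g. (\<lambda>n. of_bool (all_bits ?S (str n))) = coloring_code g \<and>
      (\<forall>t\<in>{(i, \<sigma>). (i = False \<longrightarrow> dense_str {\<tau>. g \<tau> = False}) \<and>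
          (i = True \<longrightarrow> dense_above {\<tau>. g \<tau> = True} \<sigma>)}.
        \<exists>s\<in>{(i, \<sigma>). (i = False \<longrightarrow> dense_str {\<tau>. f \<tau> = False}) \<and>
            (i = True \<longrightarrow> (\<forall>\<tau>. prefix \<sigma> \<tau> \<longrightarrow> f \<tau> = True))}.
          (\<lambda>n. prod_encode (fst (prod_decode ((coloring_code f \<oplus> pair_code t) 1)),
            settle (\<lambda>n. refuted (\<lambda>n. (coloring_code f \<oplus> pair_code t) (2 * n)) (Suc (2 * n)))
              (length (str (snd (prod_decode ((coloring_code f \<oplus> pair_code t) 1))))))) = pair_code s)"
    (is "\<exists>g. _ \<and> (\<forall>t\<in>?T g. \<exists>s\<in>?Sol. ?\<Psi> t = _)")
  proof (intro exI[of _ "all_bits ?S"] conjI ballI)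
    show "(\<lambda>n. of_bool (all_bits ?S (str n))) = coloring_code (all_bits ?S)"
      by (simp add: coloring_code_def fun_eq_iff)
    fix t assume "t \<in> ?T (all_bits ?S)"
    then obtain i \<sigma> where t: "t = (i, \<sigma>)"
      and dense: "i = False \<Longrightarrow> dense_str {\<tau>. all_bits ?S \<tau> = False}"
        "i = True \<Longrightarrow> dense_above {\<tau>. all_bits ?S \<tau> = True} \<sigma>" by blast
    define c where "c = settle (\<lambda>n. refuted (coloring_code f) (Suc (2 * n))) (length \<sigma>)"
    have "(i, str c) \<in> ?Sol"
    proof (cases i)
      case True
      with dense have "\<forall>u\<in>?S. u < length \<sigma>" using all_bits_dense_above_length by blast
      from refuted_odd.not_R_settle_final[OF this]
      have "\<not> (\<exists>s. refuted (coloring_code f) (Suc (2 * c)) s)" by (simp add: c_def)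
      with True show ?thesis unfolding refuted_coloring_code_iff by simp
    next
      case False
      with dense(1) have "infinite ?S" using all_bits_not_dense_str by blast
      have "\<exists>\<tau>. prefix \<rho> \<tau> \<and> f \<tau> = False" for \<rho>
        using refuted_odd.infinite_movesD[OF \<open>infinite ?S\<close>, of "str_code \<rho>"]
        unfolding refuted_coloring_code_iff by simp
      with False show ?thesis by (simp add: dense_above_def Bex_def conj_commute)
    qed
    moreover have "?\<Psi> t = pair_code (i, str c)"
      by (simp add: t pair_code_def c_def fun_eq_iff)
    ultimately show "\<exists>s\<in>?Sol. ?\<Psi> t = pair_code s" by blast
  qed
qed

section \<open>Trees\<close>

text \<open>The two one-bit extensions of a node lead into disjoint cones, so \<open>h\<close> also
  reflects the prefix order.\<close>

lemma iso_full_tree_range: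
  assumes step: "\<And>\<rho> b. prefix (h \<rho> @ [b]) (h (\<rho> @ [b]))"
  shows "iso_full_tree (range h)"
proof -
  have mono: "prefix (h \<rho>) (h (\<rho> @ \<tau>))" for \<rho> \<tau>
  proof (induction \<tau> rule: rev_induct)
    case (snoc b \<tau>)
    then show ?case
      using step[of "\<rho> @ \<tau>" b] by (metis append_assoc append_prefixD prefix_order.order_trans)
  qed simp
  have next_mono: "prefix (h \<rho> @ [b]) (h (\<rho> @ b # \<tau>))" for \<rho> b \<tau>
    using step[of \<rho> b] mono[of "\<rho> @ [b]" \<tau>] by (auto intro: prefix_order.order_trans)
  have iff: "prefix (h \<rho>) (h \<tau>) \<longleftrightarrow> prefix \<rho> \<tau>" for \<rho> \<tau>
  proof
    assume "prefix \<rho> \<tau>"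
    then show "prefix (h \<rho>) (h \<tau>)" using mono by (auto simp: prefix_def)
  next
    assume le: "prefix (h \<rho>) (h \<tau>)"
    show "prefix \<rho> \<tau>"
    proof (cases rule: prefix_cases[of \<rho> \<tau>])
      case 2
      then obtain b \<upsilon> where "\<rho> = \<tau> @ b # \<upsilon>" by (auto elim: strict_prefixE')
      with next_mono[of \<tau> b \<upsilon>] have "length (h \<tau>) < length (h \<rho>)"
        by (metis Suc_le_eq length_append_singleton prefix_length_le)
      with prefix_length_le[OF le] show ?thesis by simp
    next
      case 3
      from parallel_decomp[OF this] obtain \<upsilon> b \<mu> c \<nu>
        where *: "b \<noteq> c" "\<rho> = \<upsilon> @ b # \<mu>" "\<tau> = \<upsilon> @ c # \<nu>" by blast
      have "prefix (h \<upsilon> @ [b]) (h \<tau>)"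
        using next_mono[of \<upsilon> b \<mu>] le *(2) prefix_order.order_trans by metis
      moreover have "prefix (h \<upsilon> @ [c]) (h \<tau>)"
        using next_mono[of \<upsilon> c \<nu>] *(3) by simp
      ultimately have "[b] = [c]" by (auto simp: prefix_def)
      with * show ?thesis by simp
    qed
  qed
  have "inj h" by (rule injI) (metis iff prefix_order.eq_iff)
  then show ?thesis
    unfolding iso_full_tree_def using iff by (auto simp: bij_betw_def)
qed

section \<open>Trees closed under longest common prefixes\<close>

abbreviation (input) lcp where "lcp \<equiv> longest_common_prefix"

lemma lcp_eqI:
  assumes "prefix \<rho> \<sigma>" "prefix \<rho> \<tau>" "\<And>\<pi>. prefix \<pi> \<sigma> \<Longrightarrow> prefix \<pi> \<tau> \<Longrightarrow> prefix \<pi> \<rho>"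
  shows "lcp \<sigma> \<tau> = \<rho>"
  using assms longest_common_prefix_prefix1 longest_common_prefix_prefix2
    longest_common_prefix_max_prefix by (metis prefix_order.antisym)

lemma lcp_commute: "lcp \<sigma> \<tau> = lcp \<tau> \<sigma>"
  by (rule lcp_eqI) (auto intro: longest_common_prefix_prefix1 longest_common_prefix_prefix2
      longest_common_prefix_max_prefix)

lemma lcp_self: "lcp \<sigma> \<sigma> = \<sigma>"
  by (rule lcp_eqI) auto

text \<open>Closure under longest common prefixes gives a least member of \<open>H\<close> above
  each string that has one; passing to least members reaches every element.\<close>

lemma iso_full_tree_of_lcp_closed:
  assumes root: "H \<noteq> {}"
    and succ: "\<And>\<rho> b. \<rho> \<in> H \<Longrightarrow> \<exists>\<tau>\<in>H. prefix (\<rho> @ [b]) \<tau>"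
    and closed: "\<And>\<sigma> \<tau>. \<sigma> \<in> H \<Longrightarrow> \<tau> \<in> H \<Longrightarrow> lcp \<sigma> \<tau> \<in> H"
  shows "iso_full_tree H"
proof -
  \<comment> \<open>A member of minimal length above \<pi> is least: its longest common prefix with
    another such member again lies in \<open>H\<close> above \<pi>.\<close>
  define e where "e \<pi> = arg_min length (\<lambda>\<tau>. \<tau> \<in> H \<and> prefix \<pi> \<tau>)" for \<pi>
  have e: "e \<pi> \<in> H" "prefix \<pi> (e \<pi>)" "\<And>\<tau>. \<tau> \<in> H \<Longrightarrow> prefix \<pi> \<tau> \<Longrightarrow> prefix (e \<pi>) \<tau>"
    if ex: "\<exists>\<tau>\<in>H. prefix \<pi> \<tau>" for \<pi>
  proof -
    have min: "e \<pi> \<in> H \<and> prefix \<pi> (e \<pi>)"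
      unfolding e_def using ex by (metis (mono_tags, lifting) arg_min_natI)
    then show "e \<pi> \<in> H" "prefix \<pi> (e \<pi>)" by auto
    fix \<tau> assume \<tau>: "\<tau> \<in> H" "prefix \<pi> \<tau>"
    have "lcp (e \<pi>) \<tau> \<in> H" "prefix \<pi> (lcp (e \<pi>) \<tau>)"
      using closed min \<tau> by (auto intro: longest_common_prefix_max_prefix)
    then have "length (e \<pi>) \<le> length (lcp (e \<pi>) \<tau>)"
      unfolding e_def[of \<pi>] by (intro arg_min_nat_le) auto
    then have "lcp (e \<pi>) \<tau> = e \<pi>"
      using longest_common_prefix_prefix1[of "e \<pi>" \<tau>] by (metis prefix_length_le prefix_length_prefix prefix_order.eq_iff)
    then show "prefix (e \<pi>) \<tau>" by (metis longest_common_prefix_prefix2)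
  qed
  define h where "h = foldl (\<lambda>\<rho> b. e (\<rho> @ [b])) (e [])"
  have h_Nil: "h [] = e []" and h_snoc: "h (\<rho> @ [b]) = e (h \<rho> @ [b])" for \<rho> b
    by (simp_all add: h_def)
  have ex_root: "\<exists>\<tau>\<in>H. prefix [] \<tau>" using root by auto
  have h_in: "h \<rho> \<in> H" for \<rho>
    by (induction \<rho> rule: rev_induct) (use ex_root succ e(1) in \<open>auto simp: h_Nil h_snoc\<close>)
  have "prefix (h \<rho> @ [b]) (h (\<rho> @ [b]))" for \<rho> b
    unfolding h_snoc using h_in succ e(2) by blast
  then have "iso_full_tree (range h)" by (rule iso_full_tree_range)
  moreover have "range h = H"
  proof (intro subset_antisym subsetI)
    fix \<tau> assume \<tau>: "\<tau> \<in> H"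
    \<comment> \<open>The longest node \<open>h \<rho>\<close> below \<tau> must be \<tau>;
      otherwise the next bit of \<tau> leads to a longer node below \<tau>.\<close>
    define L where "L = {length (h \<rho>) | \<rho>. prefix (h \<rho>) \<tau>}"
    have "L \<subseteq> {..length \<tau>}" unfolding L_def by (auto intro: prefix_length_le)
    then have fin: "finite L" by (rule finite_subset) simp
    have "prefix (h []) \<tau>" unfolding h_Nil using e(3)[OF ex_root \<tau>] by simp
    then have "length (h []) \<in> L" unfolding L_def by blast
    then have "Max L \<in> L" using fin Max_in by blast
    then obtain \<rho> where \<rho>: "prefix (h \<rho>) \<tau>" "Max L = length (h \<rho>)" unfolding L_def by blast
    show "\<tau> \<in> range h"
    proof (rule ccontr)
      assume "\<tau> \<notin> range h"
      then have "strict_prefix (h \<rho>) \<tau>" using \<rho>(1) by (metis prefix_order.le_less rangeI)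
      then obtain b where b: "prefix (h \<rho> @ [b]) \<tau>" by (auto elim!: strict_prefixE')
      then have "prefix (h (\<rho> @ [b])) \<tau>" unfolding h_snoc using \<tau> by (intro e(3)) auto
      then have "length (h (\<rho> @ [b])) \<in> L" unfolding L_def by blast
      then have "length (h (\<rho> @ [b])) \<le> length (h \<rho>)" using fin Max_ge \<rho>(2) by fastforce
      moreover have "prefix (h \<rho> @ [b]) (h (\<rho> @ [b]))"
        unfolding h_snoc using \<tau> b by (intro e(2)) auto
      ultimately show False using prefix_length_le by fastforce
    qed
  qed (use h_in in auto)
  ultimately show ?thesis by simp
qed

text \<open>
  Scanning the strings in the order of their codes and taking a string whenever the result stays
  closed under longest common prefixes decides membership without any search, and never blocks a
  branch.
\<close>

lemma iso_full_tree_greedy: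
  assumes H: "\<And>\<tau>. \<tau> \<in> H \<longleftrightarrow> prefix \<sigma> \<tau> \<and> f \<tau> = i \<and>
      (\<forall>\<tau>'\<in>H. str_code \<tau>' < str_code \<tau> \<longrightarrow> lcp \<tau> \<tau>' \<in> H)"
    and dense: "dense_above {\<tau>. f \<tau> = i} \<sigma>"
  shows "iso_full_tree H"
proof -
  have least: "\<exists>\<tau>. prefix \<rho> \<tau> \<and> f \<tau> = i \<and>
      (\<forall>\<tau>'. prefix \<rho> \<tau>' \<and> f \<tau>' = i \<longrightarrow> str_code \<tau> \<le> str_code \<tau>')"
    if "prefix \<sigma> \<rho>" for \<rho>
  proof -
    let ?P = "\<lambda>\<tau>. prefix \<rho> \<tau> \<and> f \<tau> = i"
    have "\<exists>\<tau>. ?P \<tau>" using dense that unfolding dense_above_def by blast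
    then have "?P (arg_min str_code ?P)" by (metis (mono_tags, lifting) arg_min_natI)
    then show ?thesis using arg_min_nat_le[of ?P _ str_code] by blast
  qed
  have closed: "lcp \<rho> \<tau> \<in> H" if "\<rho> \<in> H" "\<tau> \<in> H" for \<rho> \<tau>
  proof (rule linorder_cases[of "str_code \<rho>" "str_code \<tau>"])
    assume "str_code \<rho> < str_code \<tau>"
    then show ?thesis using H[of \<tau>] that by (metis lcp_commute)
  next
    assume "str_code \<rho> = str_code \<tau>"
    then have "\<rho> = \<tau>" by (metis str_str_code)
    with that show ?thesis by (simp add: lcp_self)
  next
    assume "str_code \<tau> < str_code \<rho>"
    then show ?thesis using H[of \<rho>] that by metis
  qed
  show ?thesis
  proof (rule iso_full_tree_of_lcp_closed[OF _ _ closed])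
    obtain \<tau> where \<tau>: "prefix \<sigma> \<tau>" "f \<tau> = i"
      "\<And>\<tau>'. prefix \<sigma> \<tau>' \<Longrightarrow> f \<tau>' = i \<Longrightarrow> str_code \<tau> \<le> str_code \<tau>'"
      using least[of \<sigma>] by blast
    have "\<not> str_code \<tau>' < str_code \<tau>" if "\<tau>' \<in> H" for \<tau>'
      using \<tau>(3) that H[of \<tau>'] by (simp add: not_less)
    with \<tau> have "\<tau> \<in> H" using H by blast
    then show "H \<noteq> {}" by blast
  next
    fix \<rho> b assume \<rho>: "\<rho> \<in> H"
    show "\<exists>\<tau>\<in>H. prefix (\<rho> @ [b]) \<tau>"
    proof (rule ccontr)
      assume none: "\<not> ?thesis"
      have "prefix \<sigma> (\<rho> @ [b])" using \<rho> H[of \<rho>] by (simp add: prefix_prefix)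
      then obtain \<tau> where \<tau>: "prefix (\<rho> @ [b]) \<tau>" "f \<tau> = i" using least by blast
      have "prefix \<rho> \<tau>" using \<tau>(1) by (rule append_prefixD)
      have "lcp \<tau> \<tau>' \<in> H" if \<tau>': "\<tau>' \<in> H" for \<tau>'
      proof -
        \<comment> \<open>No member lies above the one-bit extension, so \<tau> and \<rho> branch
          off from \<tau>' at the same node; closure for \<rho> then forces \<tau> to be
          taken.\<close>
        have "lcp \<tau> \<tau>' = lcp \<rho> \<tau>'"
        proof (rule lcp_eqI)
          show "prefix (lcp \<rho> \<tau>') \<tau>"
            using longest_common_prefix_prefix1[of \<rho> \<tau>'] \<open>prefix \<rho> \<tau>\<close> by (rule prefix_order.trans)
          show "prefix (lcp \<rho> \<tau>') \<tau>'" by (rule longest_common_prefix_prefix2)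
          fix \<pi> assume \<pi>: "prefix \<pi> \<tau>" "prefix \<pi> \<tau>'"
          have "\<not> prefix (\<rho> @ [b]) \<pi>" using none \<tau>' \<pi>(2) prefix_order.trans by blast
          then have "prefix \<pi> \<rho>"
            using prefix_same_cases[OF \<pi>(1) \<tau>(1)] by auto
          then show "prefix \<pi> (lcp \<rho> \<tau>')" using \<pi>(2) by (rule longest_common_prefix_max_prefix)
        qed
        then show ?thesis using closed[OF \<rho> \<tau>'] by simp
      qed
      moreover have "prefix \<sigma> \<tau>" using \<open>prefix \<sigma> (\<rho> @ [b])\<close> \<tau>(1) by (rule prefix_order.trans)
      ultimately have "\<tau> \<in> H" using H \<tau>(2) by blast
      with none \<tau>(1) show False by blast
    qed
  qed
qed

section \<open>Greedy construction of a tree\<close>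

text \<open>For \<open>m < n\<close> the bounds lose nothing, since a prefix of \<open>str m\<close>
  has code at most \<open>m\<close>; only values of \<open>E\<close> below \<open>n\<close> are
  consulted.\<close>

definition lcp_in :: "(nat \<Rightarrow> bool) \<Rightarrow> nat \<Rightarrow> nat \<Rightarrow> bool" where
  "lcp_in E n m \<longleftrightarrow> (\<exists>c<n. E c \<and> prefix (str c) (str n) \<and> prefix (str c) (str m) \<and>
     (\<forall>d<n. prefix (str d) (str n) \<and> prefix (str d) (str m) \<longrightarrow> prefix (str d) (str c)))"

lemma lcp_in_iff:
  assumes "m < n"
  shows "lcp_in E n m \<longleftrightarrow> E (str_code (lcp (str n) (str m)))"
proof -
  have small: "str_code \<pi> < n" if "prefix \<pi> (str m)" for \<pi>
    using str_code_mono[OF that] assms by simp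
  show ?thesis
  proof
    assume "lcp_in E n m"
    then obtain c where c: "E c" "prefix (str c) (str n)" "prefix (str c) (str m)"
      "\<And>d. d < n \<Longrightarrow> prefix (str d) (str n) \<Longrightarrow> prefix (str d) (str m) \<Longrightarrow> prefix (str d) (str c)"
      unfolding lcp_in_def by blast
    have "lcp (str n) (str m) = str c"
      using c(2-) small by (intro lcp_eqI) (metis str_str_code)+
    with c(1) show "E (str_code (lcp (str n) (str m)))" by simp
  next
    assume "E (str_code (lcp (str n) (str m)))"
    then show "lcp_in E n m"
      unfolding lcp_in_def using small[OF longest_common_prefix_prefix2]
      by (intro exI[of _ "str_code (lcp (str n) (str m))"])
        (auto intro: longest_common_prefix_prefix1 longest_common_prefix_prefix2
          longest_common_prefix_max_prefix)
  qed
qed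

text \<open>The first \<open>n\<close> values of the characteristic function of the greedy set, as binary digits.\<close>

definition greedy_bits :: "(nat \<Rightarrow> bool) \<Rightarrow> nat \<Rightarrow> nat" where
  "greedy_bits A n = rec_nat 0 (\<lambda>n B. B +
     of_bool (A n \<and> (\<forall>m<n. odd (B div 2 ^ m) \<longrightarrow> lcp_in (\<lambda>c. odd (B div 2 ^ c)) n m)) * 2 ^ n) n"

definition greedy :: "(nat \<Rightarrow> bool) \<Rightarrow> nat \<Rightarrow> bool" where
  "greedy A n \<longleftrightarrow> odd (greedy_bits A (Suc n) div 2 ^ n)"

lemma greedy_bits_less: "greedy_bits A n < 2 ^ n"
  by (induction n) (auto simp: greedy_bits_def of_bool_def)

text \<open>Stage \<open>n\<close> adds 0 or \<open>2 ^ n\<close>, so the digits below stay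
  fixed.\<close>

lemma odd_greedy_bits: "m < n \<Longrightarrow> odd (greedy_bits A n div 2 ^ m) \<longleftrightarrow> greedy A m"
proof (induction n)
  case (Suc n)
  show ?case
  proof (cases "m = n")
    case False
    with Suc.prems have "m < n" by simp
    then have pow: "(2::nat) ^ n = 2 ^ m * 2 ^ (n - m)" "even ((2::nat) ^ (n - m))"
      by (simp_all add: power_add[symmetric])
    have "\<exists>b. greedy_bits A (Suc n) = greedy_bits A n + of_bool b * 2 ^ n"
      by (auto simp: greedy_bits_def)
    then obtain b where "greedy_bits A (Suc n) = greedy_bits A n + 2 ^ m * (of_bool b * 2 ^ (n - m))"
      unfolding pow(1) by (metis mult.left_commute)
    then have "greedy_bits A (Suc n) div 2 ^ m = of_bool b * 2 ^ (n - m) + greedy_bits A n div 2 ^ m"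
      by simp
    with pow(2) Suc.IH[OF \<open>m < n\<close>] show ?thesis by simp
  qed (simp add: greedy_def)
qed simp

text \<open>When \<open>n\<close> is scanned, the digits collected so far are the values of
  \<open>greedy\<close> below \<open>n\<close>, and the longest common prefix has code at most
  \<open>m\<close>.\<close>

lemma greedy_iff:
  "greedy A n \<longleftrightarrow> A n \<and> (\<forall>m<n. greedy A m \<longrightarrow> greedy A (str_code (lcp (str n) (str m))))"
proof -
  define B where "B = greedy_bits A n"
  define b where "b \<longleftrightarrow> A n \<and> (\<forall>m<n. odd (B div 2 ^ m) \<longrightarrow> lcp_in (\<lambda>c. odd (B div 2 ^ c)) n m)"
  have "greedy_bits A (Suc n) = B + of_bool b * 2 ^ n"
    by (simp add: greedy_bits_def B_def b_def)
  then have "greedy_bits A (Suc n) div 2 ^ n = of_bool b"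
    using greedy_bits_less[of A n] by (simp add: B_def)
  then have "greedy A n \<longleftrightarrow> b" by (simp add: greedy_def)
  moreover have odd: "odd (B div 2 ^ m) \<longleftrightarrow> greedy A m" if "m < n" for m
    using that by (simp add: B_def odd_greedy_bits)
  have "lcp_in (\<lambda>c. odd (B div 2 ^ c)) n m \<longleftrightarrow> greedy A (str_code (lcp (str n) (str m)))" if "m < n" for m
    unfolding lcp_in_iff[OF that]
    using odd str_code_mono[OF longest_common_prefix_prefix2, of "str n" "str m"] that by simp
  with odd have "b \<longleftrightarrow> A n \<and> (\<forall>m<n. greedy A m \<longrightarrow> greedy A (str_code (lcp (str n) (str m))))"
    unfolding b_def by blast
  ultimately show ?thesis by blast
qed

lemma decidable_greedy:
  assumes A: "decidable 1 (\<lambda>x ns. A x (hd ns))" and B: "computable k B"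
  shows "decidable k (\<lambda>x ns. greedy (A x) (B x ns))"
proof -
  have A': "decidable k (\<lambda>x ns. A x (N x ns))" if "computable k N" for k N
    using computable_compose1[of "\<lambda>x n. of_bool (A x n)", OF _ that] A by (simp add: decidable_def)
  have "computable 1 (\<lambda>x ns. of_bool (greedy (A x) (hd ns)))"
    unfolding greedy_def greedy_bits_def lcp_in_def
    by (intro comp_intros A') simp_all
  from computable_compose1[OF this B] show ?thesis unfolding decidable_def .
qed

text \<open>The colouring is passed on unchanged; the solution names the cone and the colour from
  which the greedy set is drawn.\<close>

lemma TT12_le_V0: "TT12 \<le>\<^sub>W V0"
  unfolding TT12_def V0_def
proof (rule coloring_problem_leI[where \<Phi> = "\<lambda>x n. x n" and
      \<Psi> = "\<lambda>z n. of_bool (greedy (\<lambda>n. prefix (str (snd (prod_decode (z 1)))) (str n) \<and>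
        z (2 * n) = fst (prod_decode (z 1))) n)"])
  show "computable 1 (\<lambda>x ns. x (hd ns))" by (intro comp_intros) simp
  show "computable 1 (\<lambda>x ns. of_bool (greedy (\<lambda>n. prefix (str (snd (prod_decode (x 1)))) (str n) \<and>
        x (2 * n) = fst (prod_decode (x 1))) (hd ns)))"
    by (intro comp_intros decidable_greedy) simp_all
  fix f
  show "\<exists>g. (\<lambda>n. coloring_code f n) = coloring_code g \<and>
      (\<forall>t\<in>{(i, \<sigma>). dense_above {\<tau>. g \<tau> = i} \<sigma>}.
        \<exists>H\<in>{H. iso_full_tree H \<and> monochromatic f H}.
          (\<lambda>n. of_bool (greedy (\<lambda>n. prefix (str (snd (prod_decode ((coloring_code f \<oplus> pair_code t) 1)))) (str n) \<and>
            (coloring_code f \<oplus> pair_code t) (2 * n) = fst (prod_decode ((coloring_code f \<oplus> pair_code t) 1))) n))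
          = set_code H)"
    (is "\<exists>g. _ \<and> (\<forall>t\<in>?T g. \<exists>H\<in>?Sol. ?\<Psi> t = _)")
  proof (intro exI[of _ f] conjI ballI)
    fix t assume "t \<in> ?T f"
    then obtain i \<sigma> where t: "t = (i, \<sigma>)" and dense: "dense_above {\<tau>. f \<tau> = i} \<sigma>" by blast
    define A where "A n \<longleftrightarrow> prefix \<sigma> (str n) \<and> f (str n) = i" for n
    define H where "H = {\<tau>. greedy A (str_code \<tau>)}"
    have H: "\<tau> \<in> H \<longleftrightarrow> prefix \<sigma> \<tau> \<and> f \<tau> = i \<and>
      (\<forall>\<tau>'\<in>H. str_code \<tau>' < str_code \<tau> \<longrightarrow> lcp \<tau> \<tau>' \<in> H)" for \<tau>
    proof -
      have "(\<forall>m<str_code \<tau>. greedy A m \<longrightarrow> greedy A (str_code (lcp \<tau> (str m)))) \<longleftrightarrow>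
          (\<forall>\<tau>'. str_code \<tau>' < str_code \<tau> \<longrightarrow> \<tau>' \<in> H \<longrightarrow> lcp \<tau> \<tau>' \<in> H)"
        unfolding H_def mem_Collect_eq by (metis str_code_str str_str_code)
      then show ?thesis
        using greedy_iff[of A "str_code \<tau>"] unfolding H_def[THEN eqset_imp_iff, of \<tau>]
        by (auto simp: A_def)
    qed
    from iso_full_tree_greedy[OF H dense] have "iso_full_tree H" .
    moreover have "monochromatic f H" unfolding monochromatic_def using H by blast
    moreover have "?\<Psi> t = set_code H"
    proof
      fix n
      have "coloring_code f n = of_bool i \<longleftrightarrow> f (str n) = i" for n
        by (cases i) (simp_all add: coloring_code_def)
      then show "?\<Psi> t n = set_code H n"
        by (simp add: t pair_code_def set_code_def H_def A_def[abs_def])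
    qed
    ultimately show "\<exists>H\<in>?Sol. ?\<Psi> t = set_code H" by blast
  qed simp
qed

section \<open>Continuity of Turing functionals\<close>

text \<open>This is the neighbourhood filter of \<open>x\<close> in Baire space; filters combine the
  use bounds of subcomputations.\<close>

definition near :: "baire \<Rightarrow> baire filter" where
  "near x = (INF u. principal {x'. \<forall>n<u. x' n = x n})"

lemma eventually_near: "eventually P (near x) \<longleftrightarrow> (\<exists>u. \<forall>x'. (\<forall>n<u. x' n = x n) \<longrightarrow> P x')"
  unfolding near_def
proof (subst eventually_INF_base)
  fix u v :: nat
  show "\<exists>w\<in>UNIV. principal {x'. \<forall>n<w. x' n = x n} \<le>
      inf (principal {x'. \<forall>n<u. x' n = x n}) (principal {x'. \<forall>n<v. x' n = x n})"
    by (intro bexI[of _ "max u v"]) auto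
qed (auto simp: eventually_principal)

text \<open>A halting computation makes only finitely many queries.\<close>

lemma rec_eval_near: "rec_eval x e ns r \<Longrightarrow> eventually (\<lambda>x'. rec_eval x' e ns r) (near x)"
proof (induction rule: rec_eval.induct)
  case (rec_eval_Query n)
  show ?case
    unfolding eventually_near
    by (rule exI[of _ "Suc n"]) (metis lessI rec_eval.rec_eval_Query)
next
  case (rec_eval_Comp ns gs vs f r)
  then have len: "length gs = length vs"
    and "\<forall>i\<in>{..<length gs}. eventually (\<lambda>x'. rec_eval x' (gs ! i) ns (vs ! i)) (near x)"
    by (auto simp: list_all2_conv_all_nth)
  then have "eventually (\<lambda>x'. \<forall>i\<in>{..<length gs}. rec_eval x' (gs ! i) ns (vs ! i)) (near x)"
    by (intro eventually_ball_finite) auto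
  with rec_eval_Comp.IH(2) show ?case
    by eventually_elim (use len in \<open>auto simp: list_all2_conv_all_nth intro!: rec_eval.rec_eval_Comp\<close>)
next
  case (rec_eval_PrimRec_0 g ns r h)
  from rec_eval_PrimRec_0.IH show ?case
    by eventually_elim (rule rec_eval.rec_eval_PrimRec_0)
next
  case (rec_eval_PrimRec_Suc g h n ns q r)
  from rec_eval_PrimRec_Suc.IH show ?case
    by eventually_elim (rule rec_eval.rec_eval_PrimRec_Suc)
next
  case (rec_eval_Mu f n ns)
  have "eventually (\<lambda>x'. \<exists>v>0. rec_eval x' f (m # ns) v) (near x)" if "m < n" for m
  proof -
    from rec_eval_Mu that obtain v
      where "v > 0" "eventually (\<lambda>x'. rec_eval x' f (m # ns) v) (near x)" by blast
    then show ?thesis by (auto elim: eventually_mono)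
  qed
  then have "eventually (\<lambda>x'. \<forall>m\<in>{..<n}. \<exists>v>0. rec_eval x' f (m # ns) v) (near x)"
    by (intro eventually_ball_finite) auto
  with rec_eval_Mu.IH(1) show ?case
    by eventually_elim (auto intro: rec_eval.rec_eval_Mu)
qed (simp_all add: rec_eval.intros)

text \<open>The bound \<open>u\<close> covers the queries for the first \<open>k\<close> outputs;
  the functional need not be total at \<open>x'\<close>, so its output there is a
  hypothesis.\<close>

lemma turing_functional_near:
  assumes "turing_functional e x y"
  obtains u where "\<And>x' y'. \<forall>n<u. x' n = x n \<Longrightarrow> turing_functional e x' y' \<Longrightarrow> \<forall>n<k. y' n = y n"
proof -
  have "\<forall>n\<in>{..<k}. eventually (\<lambda>x'. rec_eval x' e [n] (y n)) (near x)"
    using assms by (auto simp: turing_functional_def intro: rec_eval_near)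
  then have "eventually (\<lambda>x'. \<forall>n\<in>{..<k}. rec_eval x' e [n] (y n)) (near x)"
    by (intro eventually_ball_finite) auto
  then obtain u where u: "\<And>x'. \<forall>n<u. x' n = x n \<Longrightarrow> \<forall>n<k. rec_eval x' e [n] (y n)"
    unfolding eventually_near by auto
  show thesis
  proof (rule that)
    fix x' y' assume "\<forall>n<u. x' n = x n" "turing_functional e x' y'"
    then show "\<forall>n<k. y' n = y n"
      using u rec_eval_deterministic unfolding turing_functional_def by blast
  qed
qed

text \<open>All instances are codes of colourings, so the forward functional induces a map
  \<open>G\<close> on colourings.\<close>

lemma coloring_problem_leE:
  assumes "coloring_problem c S \<le>\<^sub>W coloring_problem d T"
  obtains \<Phi> \<Psi> G where
    "\<And>f. turing_functional \<Phi> (coloring_code f) (coloring_code (G f))"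
    "\<And>f t. t \<in> T (G f) \<Longrightarrow> \<exists>s\<in>S f. turing_functional \<Psi> (coloring_code f \<oplus> d t) (c s)"
proof -
  obtain \<Phi> \<Psi> where "\<forall>x\<in>range coloring_code. \<exists>z. turing_functional \<Phi> x z \<and> z \<in> range coloring_code \<and>
     (\<forall>y\<in>sol (coloring_problem d T) z. \<exists>w. turing_functional \<Psi> (x \<oplus> y) w \<and> w \<in> sol (coloring_problem c S) x)"
    using assms unfolding weihrauch_le_def inst_coloring_problem by blast
  then have "\<forall>f. \<exists>g. turing_functional \<Phi> (coloring_code f) (coloring_code g) \<and>
      (\<forall>t\<in>T g. \<exists>s\<in>S f. turing_functional \<Psi> (coloring_code f \<oplus> d t) (c s))"
    by (force simp: sol_coloring_problem)
  then show thesis using that by metis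
qed

definition agree_below :: "nat \<Rightarrow> nat set \<Rightarrow> nat set \<Rightarrow> bool" where
  "agree_below U S S' \<longleftrightarrow> (\<forall>n<U. n \<in> S' \<longleftrightarrow> n \<in> S)"

lemma agree_below_mono: "agree_below U S S' \<Longrightarrow> V \<le> U \<Longrightarrow> agree_below V S S'"
  unfolding agree_below_def by auto

lemma agree_below_trans: "agree_below U S S' \<Longrightarrow> agree_below U S' S'' \<Longrightarrow> agree_below U S S''"
  unfolding agree_below_def by auto

text \<open>The colour of \<open>str n\<close> depends on \<open>S\<close> only below its length,
  which is at most \<open>n\<close>.\<close>

lemma coloring_code_agree:
  assumes "agree_below U S S'" "n < U"
  shows "coloring_code (last_bit S') n = coloring_code (last_bit S) n"
    and "coloring_code (all_bits S') n = coloring_code (all_bits S) n"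
proof -
  have "u \<in> S' \<longleftrightarrow> u \<in> S" if "u < length (str n)" for u
    using that assms length_le_str_code[of "str n"] by (auto simp: agree_below_def)
  then show "coloring_code (last_bit S') n = coloring_code (last_bit S) n"
    and "coloring_code (all_bits S') n = coloring_code (all_bits S) n"
    unfolding coloring_code_def last_bit_def all_bits_def by (simp_all cong: conj_cong)
qed

lemma join_agree:
  assumes "\<forall>n<u. x' n = x n" "\<forall>n<u. y' n = y n"
  shows "\<forall>n<u. (x' \<oplus> y') n = (x \<oplus> y) n"
  using assms by (simp add: join_def)

text \<open>The code of a pair is a constant function, so one value of the output already commits a
  reduction to the pair.\<close>

lemma pair_code_eq_iff [simp]: "pair_code s n = pair_code t m \<longleftrightarrow> s = t"
  using bij_str_code by (cases s; cases t) (auto simp: pair_code_def bij_is_inj inj_eq of_bool_def)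

section \<open>Separations\<close>

lemma V2_not_le_V1: "\<not> V2 \<le>\<^sub>W V1"
proof
  assume le: "V2 \<le>\<^sub>W V1"
  obtain \<Phi> \<Psi> G where
    \<Phi>: "\<And>f. turing_functional \<Phi> (coloring_code f) (coloring_code (G f))" and
    \<Psi>': "\<And>f t. t \<in> {(i, \<sigma>).
         dense_str {\<tau>. G f \<tau> = False} \<and> dense_str {\<tau>. G f \<tau> = True} \<or>
         (\<forall>\<tau>. prefix \<sigma> \<tau> \<longrightarrow> G f \<tau> = i)} \<Longrightarrow>
      \<exists>s\<in>{(i, \<sigma>). (i = False \<longrightarrow> dense_str {\<tau>. f \<tau> = False}) \<and>
          (i = True \<longrightarrow> dense_above {\<tau>. f \<tau> = True} \<sigma>)}.
        turing_functional \<Psi> (coloring_code f \<oplus> pair_code t) (pair_code s)"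
    by (rule coloring_problem_leE[OF le[unfolded V1_def V2_def]], rule that)
  define cone where "cone S t \<longleftrightarrow> (\<forall>\<tau>. prefix (snd t) \<tau> \<longrightarrow> G (all_bits S) \<tau> = fst t)" for S t
  define both where "both S \<longleftrightarrow>
    dense_str {\<tau>. G (all_bits S) \<tau> = False} \<and> dense_str {\<tau>. G (all_bits S) \<tau> = True}" for S
  have \<Psi>: "\<exists>s. (fst s = False \<longrightarrow> dense_str {\<tau>. all_bits S \<tau> = False}) \<and>
      (fst s = True \<longrightarrow> dense_above {\<tau>. all_bits S \<tau> = True} (snd s)) \<and>
      turing_functional \<Psi> (coloring_code (all_bits S) \<oplus> pair_code t) (pair_code s)"
    if "both S \<or> cone S t" for S t
    using \<Psi>'[of t "all_bits S"] that by (auto simp: both_def cone_def split_beta)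
  \<comment> \<open>An output of colour 1 is witnessed by one finite computation and so survives
    changes of \<open>S\<close> far out.\<close>
  define trap where "trap S t \<longleftrightarrow>
    (\<exists>\<sigma>. rec_eval (coloring_code (all_bits S) \<oplus> pair_code t) \<Psi> [0] (pair_code (True, \<sigma>) 0))" for S t
  have infinite_trap: "\<not> trap S t" if S: "infinite S" and t: "both S \<or> cone S t" for S t
  proof
    assume "trap S t"
    then obtain \<sigma> where \<sigma>: "rec_eval (coloring_code (all_bits S) \<oplus> pair_code t) \<Psi> [0] (pair_code (True, \<sigma>) 0)"
      unfolding trap_def by blast
    obtain s where s: "fst s = True \<longrightarrow> dense_above {\<tau>. all_bits S \<tau> = True} (snd s)"
      "turing_functional \<Psi> (coloring_code (all_bits S) \<oplus> pair_code t) (pair_code s)"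
      using \<Psi>[OF t] by blast
    then have "pair_code s 0 = pair_code (True, \<sigma>) 0"
      using rec_eval_deterministic \<sigma> unfolding turing_functional_def by blast
    with s(1) all_bits_not_dense_above[OF S] show False by simp
  qed
  \<comment> \<open>For finite \<open>S\<close> colour 0 is not dense, so the answer must be colour
    1.\<close>
  have finite_trap: "\<exists>U. \<forall>S'. agree_below U S S' \<longrightarrow> trap S' t"
    if S: "finite S" and t: "both S \<or> cone S t" for S t
  proof -
    obtain s where s: "fst s = False \<longrightarrow> dense_str {\<tau>. all_bits S \<tau> = False}"
      "turing_functional \<Psi> (coloring_code (all_bits S) \<oplus> pair_code t) (pair_code s)"
      using \<Psi>[OF t] by blast
    then obtain \<sigma> where "s = (True, \<sigma>)" using all_bits_not_dense_str[OF S] by (cases s) auto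
    with s(2) have "rec_eval (coloring_code (all_bits S) \<oplus> pair_code t) \<Psi> [0] (pair_code (True, \<sigma>) 0)"
      by (simp add: turing_functional_def)
    from rec_eval_near[OF this] obtain U where U: "\<And>x'. \<forall>n<U. x' n = (coloring_code (all_bits S) \<oplus> pair_code t) n \<Longrightarrow>
        rec_eval x' \<Psi> [0] (pair_code (True, \<sigma>) 0)"
      unfolding eventually_near by blast
    have "trap S' t" if "agree_below U S S'" for S'
      unfolding trap_def using U[OF join_agree] coloring_code_agree(2)[OF that] by auto
    then show ?thesis by blast
  qed
  \<comment> \<open>If the pair is not a cone, a counterexample \<tau> persists by continuity of the
    forward functional; otherwise the pair is trapped.\<close>
  have "\<exists>U. \<forall>S'. agree_below U S S' \<longrightarrow> trap S' t \<or> \<not> cone S' t" if S: "finite S" for S t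
  proof (cases "cone S t")
    case True
    then show ?thesis using finite_trap[OF S] by blast
  next
    case False
    then obtain \<tau> where \<tau>: "prefix (snd t) \<tau>" "G (all_bits S) \<tau> \<noteq> fst t" unfolding cone_def by blast
    obtain U where U: "\<And>x' y'. \<forall>n<U. x' n = coloring_code (all_bits S) n \<Longrightarrow>
        turing_functional \<Phi> x' y' \<Longrightarrow> \<forall>n<Suc (str_code \<tau>). y' n = coloring_code (G (all_bits S)) n"
      using turing_functional_near[OF \<Phi>[of "all_bits S"]] by blast
    have "\<not> cone S' t" if "agree_below U S S'" for S'
    proof -
      have "coloring_code (G (all_bits S')) (str_code \<tau>) = coloring_code (G (all_bits S)) (str_code \<tau>)"
        using U[OF _ \<Phi>[of "all_bits S'"]] coloring_code_agree(2)[OF that] by blast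
      then have "G (all_bits S') \<tau> = G (all_bits S) \<tau>" by (simp add: of_bool_eq_iff)
      with \<tau> show ?thesis unfolding cone_def by metis
    qed
    then show ?thesis by blast
  qed
  then obtain U where U: "\<And>S t S'. finite S \<Longrightarrow> agree_below (U S t) S S' \<Longrightarrow> trap S' t \<or> \<not> cone S' t"
    by metis
  have both_or_cone: "both S \<or> (\<exists>t. cone S t)" for S
    using not_dense_cone[of "G (all_bits S)" True] not_dense_cone[of "G (all_bits S)" False]
    unfolding both_def cone_def split_paired_Ex fst_conv snd_conv by blast
  \<comment> \<open>A pair solving the instance for the empty set: trapped at the start, it excludes
    the case of two dense colours at the end.\<close>
  then obtain t\<^sub>0 where "both {} \<or> cone {} t\<^sub>0" by blast
  with finite_trap[of "{}"] obtain U\<^sub>0 where U\<^sub>0: "\<And>S'. agree_below U\<^sub>0 {} S' \<Longrightarrow> trap S' t\<^sub>0"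
    by blast
  define t where "t k = (odd k, str (k div 2))" for k
  have t_surj: "\<exists>k. s = t k" for s
  proof
    show "s = t (2 * str_code (snd s) + of_bool (fst s))" by (cases s) (auto simp: t_def)
  qed
  \<comment> \<open>The next stage lies above all earlier ones and not below the bound for the pair
    \<open>t k\<close>, so the decision on this pair is kept.\<close>
  define new where "new k A = max (Suc (Max A)) (U A (t k))" for k A
  define A where "A = rec_nat {U\<^sub>0} (\<lambda>k A. insert (new k A) A)"
  define n where "n k = new k (A k)" for k
  define S where "S = insert U\<^sub>0 (range n)"
  have A_eq: "A k = insert U\<^sub>0 (n ` {..<k})" for k
    by (induction k) (auto simp: A_def n_def lessThan_Suc)
  then have A_less: "a < n k" if "a \<in> A k" for a k
  proof -
    have "a \<le> Max (A k)" using that A_eq by (intro Max_ge) auto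
    then show ?thesis by (simp add: n_def new_def)
  qed
  have n_mono: "strict_mono n"
    unfolding strict_mono_Suc_iff by (intro allI A_less) (simp add: A_eq)
  then have "infinite (range n)" by (simp add: finite_image_iff strict_mono_imp_inj_on)
  then have "infinite S" by (simp add: S_def)
  have agree: "agree_below (U (A k) (t k)) (A k) S" for k
    unfolding agree_below_def
  proof (intro allI impI iffI)
    fix a assume "a < U (A k) (t k)" "a \<in> S"
    then have "a < n k" "a = U\<^sub>0 \<or> a \<in> range n" by (auto simp: n_def new_def S_def)
    then show "a \<in> A k" using strict_mono_less[OF n_mono] by (auto simp: A_eq)
  qed (auto simp: A_eq S_def)
  have trapped: "trap S s \<or> \<not> cone S s" for s
  proof -
    obtain k where "s = t k" using t_surj by blast
    then show ?thesis using U[OF _ agree, of k] by (simp add: A_eq)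
  qed
  have "U\<^sub>0 < n k" for k by (rule A_less) (simp add: A_eq)
  then have "agree_below U\<^sub>0 {} S"
    unfolding agree_below_def S_def using less_asym by blast
  then have "trap S t\<^sub>0" by (rule U\<^sub>0)
  show False
  proof (cases "\<exists>s. cone S s")
    case True
    then show ?thesis using trapped infinite_trap \<open>infinite S\<close> by blast
  next
    case False
    with both_or_cone have "both S" by blast
    then show ?thesis using infinite_trap \<open>infinite S\<close> \<open>trap S t\<^sub>0\<close> by blast
  qed
qed

section \<open>Diagonalisation along finite sets of stages: trees and their tips\<close>

lemma ex_tree_embedding:
  assumes "dense_above {\<tau>. g \<tau> = i} \<sigma>"
  shows "\<exists>h. (\<forall>\<rho> b. prefix (h \<rho> @ [b]) (h (\<rho> @ [b]))) \<and> (\<forall>\<rho>. prefix \<sigma> (h \<rho>) \<and> g (h \<rho>) = i)"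
proof -
  from assms have "\<forall>\<rho>. \<exists>\<tau>. prefix \<sigma> \<rho> \<longrightarrow> g \<tau> = i \<and> prefix \<rho> \<tau>"
    unfolding dense_above_def by auto
  then obtain e where e: "\<And>\<rho>. prefix \<sigma> \<rho> \<Longrightarrow> g (e \<rho>) = i \<and> prefix \<rho> (e \<rho>)" by metis
  define h where "h = foldl (\<lambda>\<rho> b. e (\<rho> @ [b])) (e \<sigma>)"
  have h_Nil: "h [] = e \<sigma>" and h_snoc: "h (\<rho> @ [b]) = e (h \<rho> @ [b])" for \<rho> b
    by (simp_all add: h_def)
  have col: "prefix \<sigma> (h \<rho>) \<and> g (h \<rho>) = i" for \<rho>
  proof (induction \<rho> rule: rev_induct)
    case Nil
    show ?case using e[of \<sigma>] by (simp add: h_Nil)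
  next
    case (snoc b \<rho>)
    then have "prefix \<sigma> (h \<rho> @ [b])" by (simp add: prefix_prefix)
    with e[OF this] show ?case by (metis h_snoc prefix_order.order_trans)
  qed
  have "prefix (h \<rho> @ [b]) (h (\<rho> @ [b]))" for \<rho> b
    using e[of "h \<rho> @ [b]"] col[of \<rho>] by (simp add: h_snoc prefix_prefix)
  with col show ?thesis by blast
qed

lemma length_tree_embedding:
  assumes "\<And>\<rho> b. prefix (h \<rho> @ [b]) (h (\<rho> @ [b]))"
  shows "length \<rho> \<le> length (h \<rho>)"
proof (induction \<rho> rule: rev_induct)
  case (snoc b \<rho>)
  then show ?case using prefix_length_le[OF assms[of \<rho> b]] by simp
qed simp

text \<open>The first \<open>n\<close> levels of \<open>h\<close> are kept, and the node
  \<open>h \<mu>\<close> at level \<open>n\<close> is replaced by the root of the graft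
  \<open>k \<mu>\<close>.\<close>

lemma glue_tree_embeddings:
  fixes h :: "bool list \<Rightarrow> bool list"
  assumes h: "\<And>\<rho> b. prefix (h \<rho> @ [b]) (h (\<rho> @ [b]))"
    and k: "\<And>\<mu> \<rho> b. length \<mu> = n \<Longrightarrow> prefix (k \<mu> \<rho> @ [b]) (k \<mu> (\<rho> @ [b]))"
    and above: "\<And>\<mu> \<rho>. length \<mu> = n \<Longrightarrow> prefix (h \<mu>) (k \<mu> \<rho>)"
  defines "h' \<equiv> (\<lambda>\<rho>. if length \<rho> < n then h \<rho> else k (take n \<rho>) (drop n \<rho>))"
  shows "prefix (h' \<rho> @ [b]) (h' (\<rho> @ [b]))"
proof -
  consider "Suc (length \<rho>) < n" | "Suc (length \<rho>) = n" | "n \<le> length \<rho>" by linarith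
  then show ?thesis
  proof cases
    case 2
    then have "prefix (h (\<rho> @ [b])) (h' (\<rho> @ [b]))" using above by (simp add: h'_def)
    with h[of \<rho> b] have "prefix (h \<rho> @ [b]) (h' (\<rho> @ [b]))" by (rule prefix_order.trans)
    with 2 show ?thesis by (simp add: h'_def)
  next
    case 3
    then show ?thesis using k[of "take n \<rho>" "drop n \<rho>" b] by (simp add: h'_def)
  qed (use h in \<open>simp add: h'_def\<close>)
qed

definition somewhere_dense :: "(bool list \<Rightarrow> bool) \<Rightarrow> bool \<Rightarrow> bool list \<Rightarrow> bool" where
  "somewhere_dense g i \<sigma> \<longleftrightarrow> (\<exists>\<tau>. prefix \<sigma> \<tau> \<and> dense_above {\<rho>. g \<rho> = i} \<tau>)"

text \<open>Above each extension of \<sigma> there is a cone avoiding colour \<open>i\<close>, whose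
  root has the other colour.\<close>

lemma not_somewhere_dense:
  assumes "\<not> somewhere_dense g i \<sigma>"
  shows "dense_above {\<tau>. g \<tau> = (\<not> i)} \<sigma>"
  unfolding dense_above_def
proof (intro allI impI)
  fix \<rho> assume "prefix \<sigma> \<rho>"
  with assms have "\<not> dense_above {\<tau>. g \<tau> = i} \<rho>" unfolding somewhere_dense_def by blast
  then obtain \<rho>' where \<rho>': "prefix \<rho> \<rho>'" "\<And>\<tau>. prefix \<rho>' \<tau> \<Longrightarrow> g \<tau> \<noteq> i"
    unfolding dense_above_def by blast
  with \<rho>'(2)[of \<rho>'] show "\<exists>\<tau>\<in>{\<tau>. g \<tau> = (\<not> i)}. prefix \<rho> \<tau>" by auto
qed

text \<open>Finiteness keeps solutions for \<open>S'\<close> longer than its stages, so a stage at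
  or beyond \<open>U\<close> invalidates outputs of length at most \<open>U\<close>.\<close>

definition later_move :: "nat \<Rightarrow> nat set \<Rightarrow> nat set \<Rightarrow> bool" where
  "later_move U S S' \<longleftrightarrow> finite S' \<and> agree_below U S S' \<and> (\<exists>u\<in>S'. U \<le> u)"

text \<open>
  The output of the reduction on a tree of colour \<open>j\<close> uses only the part of the tree of height
  below some \<open>u\<close>, and a later move makes it wrong. Hence after such a move this part no longer
  extends to a monochromatic tree, and \<open>j\<close> is nowhere dense above one of its finitely many tips.
\<close>

lemma capture:
  assumes \<Phi>: "\<And>f. turing_functional \<Phi> (coloring_code f) (coloring_code (G f))"
    and \<Psi>: "\<forall>f H. iso_full_tree H \<and> monochromatic (G f) H \<longrightarrow>
      (\<exists>i \<sigma>. dense_above {\<tau>. f \<tau> = i} \<sigma> \<and>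
        turing_functional \<Psi> (coloring_code f \<oplus> set_code H) (pair_code (i, \<sigma>)))"
    and dense: "dense_above {\<tau>. G (last_bit S) \<tau> = j} l"
  shows "\<exists>U L. finite L \<and> (\<forall>\<mu>\<in>L. prefix l \<mu>) \<and>
    (\<forall>S'. later_move U S S' \<longrightarrow> (\<exists>\<mu>\<in>L. \<not> somewhere_dense (G (last_bit S')) j \<mu>))"
proof -
  obtain h where h: "\<And>\<rho> b. prefix (h \<rho> @ [b]) (h (\<rho> @ [b]))"
    "\<And>\<rho>. prefix l (h \<rho>)" "\<And>\<rho>. G (last_bit S) (h \<rho>) = j"
    using ex_tree_embedding[OF dense] by blast
  have "monochromatic (G (last_bit S)) (range h)" using h(3) by (auto simp: monochromatic_def)
  then obtain i \<sigma> where
    "turing_functional \<Psi> (coloring_code (last_bit S) \<oplus> set_code (range h)) (pair_code (i, \<sigma>))"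
    using \<Psi> iso_full_tree_range[of h] h(1) by blast
  then obtain u where u: "\<And>x' y'. \<forall>n<u. x' n = (coloring_code (last_bit S) \<oplus> set_code (range h)) n \<Longrightarrow>
      turing_functional \<Psi> x' y' \<Longrightarrow> \<forall>n<1. y' n = pair_code (i, \<sigma>) n"
    using turing_functional_near by blast
  \<comment> \<open>The nodes up to level \<open>u\<close>; \<open>K\<close> exceeds their codes, so
    agreement up to the use \<open>v\<close> of the forward functional keeps their colours.\<close>
  define F where "F = {\<rho>::bool list. length \<rho> \<le> u}"
  define K where "K = Suc (Max ((\<lambda>\<rho>. str_code (h \<rho>)) ` F))"
  have F: "finite F" unfolding F_def using finite_lists_length_le[of "UNIV :: bool set" u] by simp
  obtain v where v: "\<And>x' y'. \<forall>n<v. x' n = coloring_code (last_bit S) n \<Longrightarrow>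
      turing_functional \<Phi> x' y' \<Longrightarrow> \<forall>n<K. y' n = coloring_code (G (last_bit S)) n"
    using turing_functional_near[OF \<Phi>[of "last_bit S"]] by blast
  define U where "U = Max {u, v, length \<sigma>}"
  have U: "u \<le> U" "v \<le> U" "length \<sigma> \<le> U" by (simp_all add: U_def)
  define L where "L = h ` {\<mu>. length \<mu> = u}"
  have "\<exists>\<mu>\<in>L. \<not> somewhere_dense (G (last_bit S')) j \<mu>" if S': "later_move U S S'" for S'
  proof (rule ccontr)
    assume alive: "\<not> ?thesis"
    have agree: "agree_below U S S'" "finite S'" using S' by (auto simp: later_move_def)
    have old: "G (last_bit S') (h \<rho>) = j" if "length \<rho> \<le> u" for \<rho>
    proof -
      have "str_code (h \<rho>) < K"
        unfolding K_def less_Suc_eq_le using that F by (intro Max_ge) (auto simp: F_def)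
      moreover have "\<forall>n<v. coloring_code (last_bit S') n = coloring_code (last_bit S) n"
        using coloring_code_agree(1)[OF agree(1)] U(2) by simp
      ultimately have "coloring_code (G (last_bit S')) (str_code (h \<rho>)) = coloring_code (G (last_bit S)) (str_code (h \<rho>))"
        using v \<Phi> by blast
      then show ?thesis using h(3)[of \<rho>] by (cases j) (auto simp: of_bool_def split: if_splits)
    qed
    have "\<forall>\<mu>\<in>{\<mu>. length \<mu> = u}. \<exists>k. (\<forall>\<rho> b. prefix (k \<rho> @ [b]) (k (\<rho> @ [b]))) \<and>
        (\<forall>\<rho>. prefix (h \<mu>) (k \<rho>) \<and> G (last_bit S') (k \<rho>) = j)"
    proof
      fix \<mu> :: "bool list" assume "\<mu> \<in> {\<mu>. length \<mu> = u}"
      then have "somewhere_dense (G (last_bit S')) j (h \<mu>)" using alive by (auto simp: L_def)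
      then obtain \<tau> where \<tau>: "prefix (h \<mu>) \<tau>" "dense_above {\<rho>. G (last_bit S') \<rho> = j} \<tau>"
        unfolding somewhere_dense_def by blast
      from ex_tree_embedding[OF \<tau>(2)] obtain k where
        k: "\<forall>\<rho> b. prefix (k \<rho> @ [b]) (k (\<rho> @ [b]))" "\<forall>\<rho>. prefix \<tau> (k \<rho>) \<and> G (last_bit S') (k \<rho>) = j"
        by blast
      with prefix_order.trans[OF \<tau>(1)]
      show "\<exists>k. (\<forall>\<rho> b. prefix (k \<rho> @ [b]) (k (\<rho> @ [b]))) \<and>
          (\<forall>\<rho>. prefix (h \<mu>) (k \<rho>) \<and> G (last_bit S') (k \<rho>) = j)"
        by (intro exI[of _ k]) auto
    qed
    from bchoice[OF this] obtain k where "\<forall>\<mu>\<in>{\<mu>. length \<mu> = u}.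
        (\<forall>\<rho> b. prefix (k \<mu> \<rho> @ [b]) (k \<mu> (\<rho> @ [b]))) \<and>
        (\<forall>\<rho>. prefix (h \<mu>) (k \<mu> \<rho>) \<and> G (last_bit S') (k \<mu> \<rho>) = j)" ..
    then have k: "prefix (k \<mu> \<rho> @ [b]) (k \<mu> (\<rho> @ [b]))" "prefix (h \<mu>) (k \<mu> \<rho>)"
      "G (last_bit S') (k \<mu> \<rho>) = j" if "length \<mu> = u" for \<mu> \<rho> b
      using that by auto
    define h' where "h' \<rho> = (if length \<rho> < u then h \<rho> else k (take u \<rho>) (drop u \<rho>))" for \<rho>
    have h': "prefix (h' \<rho> @ [b]) (h' (\<rho> @ [b]))" for \<rho> b
      unfolding h'_def by (rule glue_tree_embeddings) (use h(1) k in auto)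
    have "G (last_bit S') (h' \<rho>) = j" for \<rho>
      using old[of \<rho>] k(3)[of "take u \<rho>"] by (simp add: h'_def)
    then have "monochromatic (G (last_bit S')) (range h')" by (auto simp: monochromatic_def)
    then obtain i' \<sigma>' where sol: "dense_above {\<tau>. last_bit S' \<tau> = i'} \<sigma>'"
      "turing_functional \<Psi> (coloring_code (last_bit S') \<oplus> set_code (range h')) (pair_code (i', \<sigma>'))"
      using \<Psi> iso_full_tree_range[of h'] h' by blast
    \<comment> \<open>A string with code below \<open>u\<close> has length below \<open>u\<close>,
      and nodes from level \<open>u\<close> on are too long; below level \<open>u\<close> the trees
      agree.\<close>
    have "str n \<in> range h' \<longleftrightarrow> str n \<in> range h" if "n < u" for n
    proof -
      have short: "length (str n) < u" using that length_le_str_code[of "str n"] by simp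
      have "length \<rho> < u" if "str n = h \<rho> \<or> str n = h' \<rho>" for \<rho>
        using length_tree_embedding[of h, OF h(1), of \<rho>] length_tree_embedding[of h', OF h', of \<rho>]
          short that by auto
      then show ?thesis unfolding h'_def image_iff by (metis (full_types))
    qed
    then have "\<forall>n<u. set_code (range h') n = set_code (range h) n" by (simp add: set_code_def)
    moreover have "\<forall>n<u. coloring_code (last_bit S') n = coloring_code (last_bit S) n"
      using coloring_code_agree(1)[OF agree(1)] U(1) by simp
    ultimately have "pair_code (i', \<sigma>') 0 = pair_code (i, \<sigma>) 0"
      using u[OF join_agree sol(2)] by simp
    \<comment> \<open>The string is the same as before, though it must now be longer than the stage
      \<open>w\<close>, which is at least \<open>U\<close>.\<close>
    then have "\<sigma>' = \<sigma>" by simp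
    moreover obtain w where "w \<in> S'" "U \<le> w" using S' by (auto simp: later_move_def)
    ultimately show False
      using last_bit_dense_above_length[OF agree(2) sol(1)] U(3) by fastforce
  qed
  moreover have "finite L" unfolding L_def using finite_lists_length_eq[of "UNIV :: bool set" u] by simp
  moreover have "\<forall>\<mu>\<in>L. prefix l \<mu>" using h(2) by (auto simp: L_def)
  ultimately show ?thesis by blast
qed

lemma V0_not_le_TT12: "\<not> V0 \<le>\<^sub>W TT12"
proof
  assume le: "V0 \<le>\<^sub>W TT12"
  obtain \<Phi> \<Psi> G where
    \<Phi>: "\<And>f. turing_functional \<Phi> (coloring_code f) (coloring_code (G f))" and
    \<Psi>': "\<And>f H. H \<in> {H. iso_full_tree H \<and> monochromatic (G f) H} \<Longrightarrow>
      \<exists>s\<in>{(i, \<sigma>). dense_above {\<tau>. f \<tau> = i} \<sigma>}.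
        turing_functional \<Psi> (coloring_code f \<oplus> set_code H) (pair_code s)"
    by (rule coloring_problem_leE[OF le[unfolded V0_def TT12_def]], rule that)
  have \<Psi>: "\<forall>f H. iso_full_tree H \<and> monochromatic (G f) H \<longrightarrow>
      (\<exists>i \<sigma>. dense_above {\<tau>. f \<tau> = i} \<sigma> \<and>
        turing_functional \<Psi> (coloring_code f \<oplus> set_code H) (pair_code (i, \<sigma>)))"
  proof (intro allI impI)
    fix f H assume "iso_full_tree H \<and> monochromatic (G f) H"
    then show "\<exists>i \<sigma>. dense_above {\<tau>. f \<tau> = i} \<sigma> \<and>
        turing_functional \<Psi> (coloring_code f \<oplus> set_code H) (pair_code (i, \<sigma>))"
      using \<Psi>'[of H f] by auto
  qed
  note capture = capture[OF \<Phi> \<Psi>]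
  obtain j l where "dense_above {\<tau>. G (last_bit {}) \<tau> = j} l" using ex_dense_above by blast
  then obtain U\<^sub>0 L where L: "finite L"
    and dead: "\<And>S. later_move U\<^sub>0 {} S \<Longrightarrow> \<exists>\<mu>\<in>L. \<not> somewhere_dense (G (last_bit S)) j \<mu>"
    using capture by metis
  \<comment> \<open>\<open>S\<close> and \<open>U\<close> secure a set of tips for good: whatever
    later move follows, \<open>j\<close> stays somewhere dense above each of them.\<close>
  have "\<exists>S U. U\<^sub>0 \<le> U \<and> agree_below U\<^sub>0 {} S \<and>
      (\<forall>S'. later_move U S S' \<longrightarrow> (\<forall>\<mu>\<in>L. somewhere_dense (G (last_bit S')) j \<mu>))"
    using L
  proof (induction L rule: finite_induct)
    case empty
    show ?case by (intro exI[of _ "{}"] exI[of _ U\<^sub>0]) (simp add: agree_below_def)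
  next
    case (insert l L)
    then obtain S U where U: "U\<^sub>0 \<le> U" "agree_below U\<^sub>0 {} S"
      "\<And>S' \<mu>. later_move U S S' \<Longrightarrow> \<mu> \<in> L \<Longrightarrow> somewhere_dense (G (last_bit S')) j \<mu>" by blast
    show ?case
    proof (cases "\<forall>S'. later_move U S S' \<longrightarrow> somewhere_dense (G (last_bit S')) j l")
      case True
      with U show ?thesis by (intro exI[of _ S] exI[of _ U]) blast
    next
      case False
      then obtain T where T: "later_move U S T" "\<not> somewhere_dense (G (last_bit T)) j l" by blast
      \<comment> \<open>For \<open>T\<close> the other colour is dense above the tip
        \<open>l\<close>, so \<open>capture\<close> applies to it with this tip as root.\<close>
      then obtain V M where M: "\<And>\<mu>. \<mu> \<in> M \<Longrightarrow> prefix l \<mu>"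
        "\<And>S'. later_move V T S' \<Longrightarrow> \<exists>\<mu>\<in>M. \<not> somewhere_dense (G (last_bit S')) (\<not> j) \<mu>"
        using capture[OF not_somewhere_dense] by metis
      have TU: "agree_below U S T" using T(1) by (simp add: later_move_def)
      \<comment> \<open>A move beyond both bounds is later for the capture and for the old
        condition, so it secures the new tip and keeps the others.\<close>
      have "somewhere_dense (G (last_bit S')) j \<mu>"
        if S': "later_move (max U V) T S'" and \<mu>: "\<mu> \<in> insert l L" for S' \<mu>
      proof -
        have agree: "agree_below U T S'" "agree_below V T S'"
          using S' agree_below_mono unfolding later_move_def by (metis max.cobounded1 max.cobounded2)+
        then have "later_move V T S'" "later_move U S S'"
          using S' agree_below_trans[OF TU] unfolding later_move_def by auto
        then obtain \<nu> where \<nu>: "\<nu> \<in> M" "\<not> somewhere_dense (G (last_bit S')) (\<not> j) \<nu>" using M(2) by blast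
        then have "dense_above {\<tau>. G (last_bit S') \<tau> = j} \<nu>"
          using not_somewhere_dense by fastforce
        then have "somewhere_dense (G (last_bit S')) j l"
          using M(1)[OF \<nu>(1)] unfolding somewhere_dense_def by blast
        with \<mu> U(3)[OF \<open>later_move U S S'\<close>] show ?thesis by blast
      qed
      moreover have "agree_below U\<^sub>0 {} T"
        using U(1,2) TU agree_below_mono agree_below_trans by blast
      ultimately show ?thesis using U(1) by (intro exI[of _ T] exI[of _ "max U V"]) auto
    qed
  qed
  then obtain S U where U: "U\<^sub>0 \<le> U" "agree_below U\<^sub>0 {} S"
    "\<And>S' \<mu>. later_move U S S' \<Longrightarrow> \<mu> \<in> L \<Longrightarrow> somewhere_dense (G (last_bit S')) j \<mu>" by blast
  \<comment> \<open>\<open>S\<close> is cut off at \<open>U\<close> to make it finite, and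
    \<open>U\<close> itself is the extra move. All tips are now secured, against the capture of the
    first tree.\<close>
  let ?S = "insert U (S \<inter> {..<U})"
  have "later_move U S ?S" "later_move U\<^sub>0 {} ?S"
    using U(1,2) by (auto simp: later_move_def agree_below_def)
  with U(3) dead show False by blast
qed

section \<open>Comparison of solution sets\<close>

lemma comparable_dense_above:
  assumes "\<forall>\<tau> \<tau>'. prefix \<sigma> \<tau> \<and> prefix \<sigma> \<tau>' \<and> f \<tau> = False \<and> f \<tau>' = False \<longrightarrow>
    prefix \<tau> \<tau>' \<or> prefix \<tau>' \<tau>"
  shows "dense_above {\<tau>. f \<tau> = True} \<sigma>"
  unfolding dense_above_def
proof (intro allI impI)
  fix \<rho> assume "prefix \<sigma> \<rho>"
  then have "prefix \<sigma> (\<rho> @ [b])" for b by (simp add: prefix_prefix)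
  \<comment> \<open>The two one-bit extensions are incomparable, so they cannot both have colour
    0.\<close>
  with assms have "f (\<rho> @ [True]) \<or> f (\<rho> @ [False])"
    using assms[rule_format, of "\<rho> @ [True]" "\<rho> @ [False]"] by auto
  then show "\<exists>\<tau>\<in>{\<tau>. f \<tau> = True}. prefix \<rho> \<tau>" by auto
qed

lemma dense_str_dense_above: "dense_str D \<Longrightarrow> dense_above D \<sigma>"
  by (simp add: dense_above_def)

theorem theorem3p4:
  "TT12 <\<^sub>W V0 \<and> V0 \<equiv>\<^sub>W V1 \<and> V1 <\<^sub>W V2 \<and> V2 \<equiv>\<^sub>W V3 \<and> V3 \<equiv>\<^sub>W V4"
proof -
  have V3_V2: "{(i, \<sigma>). (i = False \<longrightarrow> dense_str {\<tau>. f \<tau> = False}) \<and>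
      (i = True \<longrightarrow> (\<forall>\<tau> \<tau>'. prefix \<sigma> \<tau> \<and> prefix \<sigma> \<tau>' \<and> f \<tau> = False \<and> f \<tau>' = False \<longrightarrow>
        prefix \<tau> \<tau>' \<or> prefix \<tau>' \<tau>))}
    \<subseteq> {(i, \<sigma>). (i = False \<longrightarrow> dense_str {\<tau>. f \<tau> = False}) \<and>
      (i = True \<longrightarrow> dense_above {\<tau>. f \<tau> = True} \<sigma>)}" for f
    by (rule subrelI, unfold mem_Collect_eq split, elim conjE, intro conjI impI, erule mp, assumption)
      (rule comparable_dense_above, erule mp, assumption)
  have "V0 \<le>\<^sub>W V1"
    unfolding V0_def V1_def
  proof (rule coloring_problem_le_mono, clarify)
    fix f i \<sigma>
    assume "dense_str {\<tau>. f \<tau> = False} \<and> dense_str {\<tau>. f \<tau> = True} \<or>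
      (\<forall>\<tau>. prefix \<sigma> \<tau> \<longrightarrow> f \<tau> = i)"
    then have "dense_str {\<tau>. f \<tau> = i} \<or> (\<forall>\<tau>. prefix \<sigma> \<tau> \<longrightarrow> f \<tau> = i)"
      by (cases i) auto
    then show "dense_above {\<tau>. f \<tau> = i} \<sigma>"
      by (elim disjE) (erule dense_str_dense_above, erule cone_dense_above)
  qed
  \<comment> \<open>Every solution for V2 is one for V0, so V2 may replace V0 on the right.\<close>
  moreover have "V1 \<le>\<^sub>W V2"
    using V1_le_V0 unfolding V0_def V2_def
  proof (rule weihrauch_le_mono_right, clarify)
    fix f i \<sigma>
    assume "i = False \<longrightarrow> dense_str {\<tau>. f \<tau> = False}" "i = True \<longrightarrow> dense_above {\<tau>. f \<tau> = True} \<sigma>"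
    then show "dense_above {\<tau>. f \<tau> = i} \<sigma>"
      by (cases i) (auto intro: dense_str_dense_above)
  qed
  moreover have "V2 \<le>\<^sub>W V3"
    unfolding V2_def V3_def
    by (rule coloring_problem_le_mono) (rule V3_V2)
  moreover have "V3 \<le>\<^sub>W V4"
    unfolding V3_def V4_def by (rule coloring_problem_le_mono) auto
  \<comment> \<open>Both remaining reductions follow from that of V4 to V2: solutions for V4 solve
    V3, and solutions for V3 solve V2.\<close>
  moreover have "V3 \<le>\<^sub>W V2"
    using V4_le_V2 unfolding V3_def V4_def
    by (rule weihrauch_le_mono_left) auto
  moreover have "V4 \<le>\<^sub>W V3"
    using V4_le_V2 unfolding V2_def V3_def
    by (rule weihrauch_le_mono_right) (rule V3_V2)
  ultimately show ?thesis
    using TT12_le_V0 V0_not_le_TT12 V1_le_V0 V2_not_le_V1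
    unfolding weihrauch_less_def weihrauch_equiv_def by blast
qed

end
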